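(* Let $X$ be a Banach space with Pełczyński's property $(u)$, and let $C\subset X$ be a nonempty, bounded, closed convex set. Then $C$ is weakly compact if and only if $C$ has the $\mathcal{G}$-FPP for the class of affine uniformly bi-Lipschitz maps.
   Context: For a convex subset $M$ of a Banach space, $\mathcal{B}(M)$ denotes the family of all nonempty, bounded, closed convex subsets of $M$. A set $C\in\mathcal{B}(X)$ has the $\mathcal{G}$-FPP for a class $\mathcal{M}$ of mappings if for every $K\in\mathcal{B}(C)$, every mapping $f\in\mathcal{M}$ with $f(K)\subset K$ has a fixed point in $K$. A map $f\colon K\to K$ is affine if $f(tx+(1-t)y)=tf(x)+(1-t)f(y)$ for all $x,y\in K$, $t\in[0,1]$. A map $f\colon K\to K$ is uniformly Lipschitz if $\sup_{x\ne y\in K,\,p\in\mathbb{N}}\frac{\|f^p(x)-f^p(y)\|}{\|x-y\|}<\infty$, where $f^p$ is the $p$-th iterate of $f$. It is uniformly bi-Lipschitz if, in addition, $f$ is injective and its inverse $f^{-1}$ is uniformly Lipschitz. Surjectivity of $f$ is not required: $f^{-1}$ is defined on $f(K)$, its $p$-th iterate $f^{-p}$ on $f^p(K)$, and uniform Lipschitzness of the inverse means that the maps $f^{-p}\colon f^p(K)\to K$, $p\in\mathbb{N}$, are Lipschitz with a common constant. An infinite dimensional Banach space $X$ has property $(u)$ if for every weak Cauchy sequence $(y_n)$ in $X$ there is a sequence $(x_n)\subset X$ such that (1) $\sum_n x_n$ is weakly unconditionally Cauchy, i.e. $\sum_{n=1}^\infty|x^*(x_n)|<\infty$ for all $x^*\in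 X^*$, and (2) $\big(y_n-\sum_{i=1}^n x_i\big)_n$ converges weakly to zero. *)

theory Defs
  imports "HOL-Analysis.Analysis"
begin

text \<open>Initial topology of all continuous linear functionals on \<open>X\<close>, built as
  \<open>strong_operator_topology\<close> is in the library.\<close>

definition weak_topology :: "'a::real_normed_vector topology" where
  "weak_topology =
     pullback_topology UNIV (\<lambda>x (\<phi>::'a \<Rightarrow>\<^sub>L real). blinfun_apply \<phi> x) euclidean"

definition weakly_Cauchy :: "(nat \<Rightarrow> 'a::real_normed_vector) \<Rightarrow> bool" where
  "weakly_Cauchy y \<longleftrightarrow> (\<forall>\<phi>::'a \<Rightarrow>\<^sub>L real. Cauchy (\<lambda>n. blinfun_apply \<phi> (y n)))"

definition weakly_unconditionally_Cauchy :: "(nat \<Rightarrow> 'a::real_normed_vector) \<Rightarrow> bool" where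
  "weakly_unconditionally_Cauchy x \<longleftrightarrow>
     (\<forall>\<phi>::'a \<Rightarrow>\<^sub>L real. summable (\<lambda>n. \<bar>blinfun_apply \<phi> (x n)\<bar>))"

text \<open>The first conjunct says that the space is infinite dimensional. Sequences are indexed from
  \<open>0\<close>, so the partial sum subtracted from \<open>y n\<close> has the \<open>n + 1\<close> terms \<open>x 0, \<dots>, x n\<close>.\<close>

definition property_u :: "'a::banach itself \<Rightarrow> bool" where
  "property_u _ \<longleftrightarrow>
     (\<nexists>B::'a set. finite B \<and> span B = UNIV) \<and>
     (\<forall>y::nat \<Rightarrow> 'a. weakly_Cauchy y \<longrightarrow>
        (\<exists>x::nat \<Rightarrow> 'a. weakly_unconditionally_Cauchy x \<and>
           limitin weak_topology (\<lambda>n. y n - (\<Sum>i\<le>n. x i)) 0 sequentially))"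

definition bounded_closed_convex_subsets :: "'a::real_normed_vector set \<Rightarrow> 'a set set" where
  "bounded_closed_convex_subsets M = {K. K \<subseteq> M \<and> K \<noteq> {} \<and> bounded K \<and> closed K \<and> convex K}"

text \<open>A class of mappings is given by the set \<open>\<M> K\<close> of its members on each domain \<open>K\<close>.
  Maps on \<open>K\<close> are represented by total functions, whose values outside \<open>K\<close> are irrelevant.\<close>

definition has_G_FPP :: "'a::real_normed_vector set \<Rightarrow> ('a set \<Rightarrow> ('a \<Rightarrow> 'a) set) \<Rightarrow> bool" where
  "has_G_FPP C \<M> \<longleftrightarrow>
     (\<forall>K\<in>bounded_closed_convex_subsets C. \<forall>f\<in>\<M> K. f ` K \<subseteq> K \<longrightarrow> (\<exists>x\<in>K. f x = x))"

definition affine_map_on :: "'a::real_vector set \<Rightarrow> ('a \<Rightarrow> 'a) \<Rightarrow> bool" where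
  "affine_map_on K f \<longleftrightarrow>
     (\<forall>x\<in>K. \<forall>y\<in>K. \<forall>t\<in>{0..1}.
        f (t *\<^sub>R x + (1 - t) *\<^sub>R y) = t *\<^sub>R f x + (1 - t) *\<^sub>R f y)"

definition uniformly_lipschitz_on :: "'a::metric_space set \<Rightarrow> ('a \<Rightarrow> 'a) \<Rightarrow> bool" where
  "uniformly_lipschitz_on K f \<longleftrightarrow> (\<exists>L. \<forall>p. L-lipschitz_on K (f ^^ p))"

text \<open>The map \<open>f\<close> need not be onto \<open>K\<close>, so the \<open>p\<close>-th iterate of its inverse is considered on
  \<open>f\<^sup>p(K)\<close> only.\<close>

definition uniformly_bilipschitz_on :: "'a::metric_space set \<Rightarrow> ('a \<Rightarrow> 'a) \<Rightarrow> bool" where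
  "uniformly_bilipschitz_on K f \<longleftrightarrow>
     uniformly_lipschitz_on K f \<and> inj_on f K \<and>
     (\<exists>L. \<forall>p. L-lipschitz_on ((f ^^ p) ` K) (inv_into K f ^^ p))"

definition affine_uniformly_bilipschitz_maps :: "'a::real_normed_vector set \<Rightarrow> ('a \<Rightarrow> 'a) set" where
  "affine_uniformly_bilipschitz_maps K =
     {f. f ` K \<subseteq> K \<and> affine_map_on K f \<and> uniformly_bilipschitz_on K f}"

end

theory Submission
  imports Defs "HOL-Library.Diagonal_Subsequence"
begin

text \<open>Suppose first that \<open>C\<close> is weakly compact, and let \<open>f\<close> be an affine Lipschitz self-map of a closed
convex \<open>K \<subseteq> C\<close>. The average \<open>z\<close> of the first \<open>n\<close> points of an orbit satisfies
\<open>norm (f z - z) \<le> const / n\<close>, so the sets of \<open>1/n\<close>-almost fixed points are nonempty. They are closed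
and convex, hence weakly closed, and they decrease, so compactness gives a common point, which is a
fixed point (\<open>weakly_compact_imp_affine_fixed_point\<close>).

Conversely, suppose that \<open>C\<close> is not weakly compact. Then there is a sequence \<open>y\<close> in \<open>C\<close> such that the
closed convex hulls of its tails have empty intersection
(\<open>noncompact_imp_empty_tail_intersection\<close>, a version of James' construction). This property
is inherited by subsequences and by sequences of convex combinations of further and further terms.
If a sequence \<open>w\<close> has it, then the shift
\<open>w k \<mapsto> w (k + 1)\<close>, extended affinely to the closed convex hull of \<open>w\<close>, cannot have a fixed point,
because its \<open>p\<close>-th iterate takes its values in the closed convex hull of the \<open>p\<close>-th tail. The
extension exists and is uniformly bi-Lipschitz as soon as the norms of \<open>\<Sum>k. c k *\<^sub>R w k\<close> and of
\<open>\<Sum>k. c k *\<^sub>R w (k + p)\<close> are equivalent uniformly in \<open>p\<close> (\<open>shift_equivalent_imp_not_FPP\<close>). So it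
suffices to find \<open>w\<close> on whose combinations the norm is equivalent to a shift invariant one.

By Rosenthal's theorem (\<open>Rosenthal_l1\<close>), \<open>y\<close> has a subsequence that is equivalent to the unit vector
basis of \<open>\<ell>\<^sub>1\<close>, and then this subsequence will do, or one that is weakly Cauchy. In the second case
property \<open>(u)\<close> and Mazur's theorem give convex blocks \<open>w\<close> of the subsequence with
\<open>\<Sum>k. \<bar>\<phi> (w (k + 1) - w k)\<bar> < \<infinity>\<close> for every functional \<open>\<phi>\<close> (\<open>weakly_Cauchy_blocks\<close>). A weak
limit of \<open>w\<close> would lie in the closed convex hulls of all tails, so there is none, and therefore a
subsequence of \<open>w\<close> is equivalent to the summing basis of \<open>c\<^sub>0\<close> (\<open>summing_subsequence\<close>): the norm
of a combination is equivalent to the largest absolute value of a tail sum of its coefficients. A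
shift of the coefficients only repeats tail sums, so this norm is shift invariant as well.\<close>

section \<open>The Hahn--Banach theorem and separation\<close>

definition sublinear :: "('a::real_vector \<Rightarrow> real) \<Rightarrow> bool" where
  "sublinear q \<longleftrightarrow> (\<forall>x y. q (x + y) \<le> q x + q y) \<and> (\<forall>t\<ge>0. \<forall>x. q (t *\<^sub>R x) = t * q x)"

lemma sublinear_add: "sublinear q \<Longrightarrow> q (x + y) \<le> q x + q y"
  and sublinear_scale: "sublinear q \<Longrightarrow> t \<ge> 0 \<Longrightarrow> q (t *\<^sub>R x) = t * q x"
  by (auto simp: sublinear_def)

lemma sublinear_zero: "sublinear q \<Longrightarrow> q 0 = 0"
  using sublinear_scale[of q 0 0] by simp

lemma sublinear_minus_le: "sublinear q \<Longrightarrow> - q (- x) \<le> q x"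
  using sublinear_add[of q x "- x"] sublinear_zero[of q] by simp

text \<open>The infimum is subadditive because two indices can be merged into one. Positive homogeneity only
needs one inequality, since it can be applied to \<open>1/t\<close> as well; the value at \<open>0\<close> comes from
\<open>u 0 = u (2 *\<^sub>R 0) = 2 * u 0\<close>.\<close>

lemma sublinear_INF:
  fixes h :: "'i \<Rightarrow> 'a::real_vector \<Rightarrow> real"
  assumes ne: "I \<noteq> {}"
    and bdd: "\<And>x. bdd_below ((\<lambda>i. h i x) ` I)"
    and add: "\<And>i j x y. i \<in> I \<Longrightarrow> j \<in> I \<Longrightarrow> \<exists>k\<in>I. h k (x + y) \<le> h i x + h j y"
    and scale: "\<And>i t x. i \<in> I \<Longrightarrow> t > 0 \<Longrightarrow> \<exists>k\<in>I. h k (t *\<^sub>R x) \<le> t * h i x"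
  shows "sublinear (\<lambda>x. INF i\<in>I. h i x)"
proof -
  define u where "u x = (INF i\<in>I. h i x)" for x
  have lower: "u x \<le> h i x" if "i \<in> I" for i x
    unfolding u_def using bdd that by (rule cINF_lower)
  have greatest: "c \<le> u x" if "\<And>i. i \<in> I \<Longrightarrow> c \<le> h i x" for c x
    unfolding u_def using ne that by (rule cINF_greatest)
  have "u (x + y) \<le> u x + u y" for x y
  proof -
    have "u (x + y) - h i x \<le> u y" if i: "i \<in> I" for i
    proof (rule greatest)
      fix j assume "j \<in> I"
      with i add obtain k where "k \<in> I" "h k (x + y) \<le> h i x + h j y" by blast
      with lower[of k "x + y"] show "u (x + y) - h i x \<le> h j y" by linarith
    qed
    then have "u (x + y) - u y \<le> u x"
      by (intro greatest) (simp add: algebra_simps)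
    then show ?thesis by simp
  qed
  moreover have scale_le: "u (t *\<^sub>R x) \<le> t * u x" if t: "t > 0" for t x
  proof -
    have "u (t *\<^sub>R x) / t \<le> u x"
    proof (rule greatest)
      fix i assume "i \<in> I"
      with t scale obtain k where "k \<in> I" "h k (t *\<^sub>R x) \<le> t * h i x" by blast
      with lower[of k "t *\<^sub>R x"] t show "u (t *\<^sub>R x) / t \<le> h i x"
        by (simp add: field_simps)
    qed
    with t show ?thesis by (simp add: field_simps)
  qed
  have scale_eq: "u (t *\<^sub>R x) = t * u x" if t: "t > 0" for t x
  proof (rule antisym[OF scale_le[OF t]])
    have "u x \<le> (1 / t) * u (t *\<^sub>R x)"
      using scale_le[of "1 / t" "t *\<^sub>R x"] t by simp
    then show "t * u x \<le> u (t *\<^sub>R x)" using t by (simp add: field_simps)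
  qed
  moreover have "u 0 = 0" using scale_eq[of 2 0] by simp
  ultimately have "sublinear u"
    by (auto simp: sublinear_def less_eq_real_def)
  then show ?thesis by (simp add: u_def[abs_def])
qed

text \<open>Zorn's lemma applies because a chain of sublinear functionals below \<open>p\<close> is bounded below at \<open>x\<close> by
\<open>- p (- x)\<close>, so that its pointwise infimum is again sublinear. Together with the next lemma this is
the Hahn--Banach theorem, without extending anything from subspaces.\<close>

lemma minimal_sublinear_exists:
  fixes p :: "'a::real_vector \<Rightarrow> real"
  assumes p: "sublinear p"
  obtains q where "sublinear q" "\<And>x. q x \<le> p x"
    and "\<And>r. sublinear r \<Longrightarrow> (\<And>x. r x \<le> q x) \<Longrightarrow> r = q"
proof -
  define A where "A = {q. sublinear q \<and> (\<forall>x. q x \<le> p x)}"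
  define P where "P = (\<lambda>a b :: 'a \<Rightarrow> real. b \<le> a)"
  have "\<exists>m\<in>A. \<forall>a\<in>A. P m a \<longrightarrow> a = m"
  proof (rule predicate_Zorn)
    show "partial_order_on A (relation_of P A)"
      by (rule partial_order_on_relation_ofI) (auto simp: P_def)
    fix C assume C: "C \<in> Chains (relation_of P A)"
    then have CA: "C \<subseteq> A" and tot: "\<And>a b. a \<in> C \<Longrightarrow> b \<in> C \<Longrightarrow> a \<le> b \<or> b \<le> a"
      by (auto simp: Chains_def relation_of_def P_def)
    show "\<exists>u\<in>A. \<forall>a\<in>C. P a u"
    proof (cases "C = {}")
      case True
      with p show ?thesis by (auto simp: A_def)
    next
      case False
      have bdd: "bdd_below ((\<lambda>q. q x) ` C)" for x
      proof (rule bdd_belowI2)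
        fix q assume "q \<in> C"
        with CA have "sublinear q" "q (- x) \<le> p (- x)" by (auto simp: A_def)
        with sublinear_minus_le[of q x] show "- p (- x) \<le> q x" by linarith
      qed
      have low: "(INF q\<in>C. q x) \<le> q x" if "q \<in> C" for q x
        using bdd that by (rule cINF_lower)
      have "sublinear (\<lambda>x. INF q\<in>C. q x)"
      proof (rule sublinear_INF[OF False bdd])
        fix f g x y assume fg: "f \<in> C" "g \<in> C"
        then have s: "sublinear f" "sublinear g" using CA by (auto simp: A_def)
        from tot[OF fg] show "\<exists>k\<in>C. k (x + y) \<le> f x + g y"
        proof
          assume "f \<le> g"
          then have "f (x + y) \<le> f x + g y"
            using sublinear_add[OF s(1), of x y] le_funD[of f g y] by linarith
          with fg show ?thesis by blast
        next
          assume "g \<le> f"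
          then have "g (x + y) \<le> f x + g y"
            using sublinear_add[OF s(2), of x y] le_funD[of g f x] by linarith
          with fg show ?thesis by blast
        qed
      next
        fix f t x assume "f \<in> C" "(t::real) > 0"
        then show "\<exists>k\<in>C. k (t *\<^sub>R x) \<le> t * f x"
          using CA by (intro bexI[of _ f]) (auto simp: A_def sublinear_scale)
      qed
      moreover have "(INF q\<in>C. q x) \<le> p x" for x
      proof -
        from False obtain q where "q \<in> C" by blast
        with CA have "q x \<le> p x" by (auto simp: A_def)
        with low[OF \<open>q \<in> C\<close>, of x] show ?thesis by linarith
      qed
      ultimately show ?thesis
        using low by (intro bexI[of _ "\<lambda>x. INF q\<in>C. q x"]) (auto simp: A_def P_def le_fun_def)
    qed
  qed
  then obtain q where q: "q \<in> A" and min: "\<And>a. a \<in> A \<Longrightarrow> a \<le> q \<Longrightarrow> a = q"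
    by (auto simp: P_def)
  show thesis
  proof (rule that[of q])
    show "sublinear q" "q x \<le> p x" for x using q by (auto simp: A_def)
    fix r assume r: "sublinear r" "\<And>x. r x \<le> q x"
    from q have "q x \<le> p x" for x by (auto simp: A_def)
    with r have "r \<in> A" unfolding A_def by (auto intro: order_trans)
    with r show "r = q" by (intro min) (auto simp: le_fun_def)
  qed
qed

text \<open>For a direction \<open>a\<close>, the infimum over \<open>t \<ge> 0\<close> of \<open>q (x + t *\<^sub>R a) - t * q a\<close> is a sublinear functional
below \<open>q\<close>, hence equal to \<open>q\<close>. Taking \<open>t = 1\<close> shows that \<open>q\<close> is superadditive.\<close>

lemma minimal_sublinear_imp_linear:
  fixes q :: "'a::real_vector \<Rightarrow> real"
  assumes q: "sublinear q"
    and min: "\<And>r. sublinear r \<Longrightarrow> (\<And>x. r x \<le> q x) \<Longrightarrow> r = q"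
  shows "linear q"
proof -
  have superadd: "q x + q a \<le> q (x + a)" for x a
  proof -
    define h where "h t x = q (x + t *\<^sub>R a) - t * q a" for t x
    have bdd: "bdd_below ((\<lambda>t. h t x) ` {0..})" for x
    proof (rule bdd_belowI2)
      fix t :: real assume "t \<in> {0..}"
      then have "t * q a = q ((x + t *\<^sub>R a) + (- x))" using q by (simp add: sublinear_scale)
      also have "\<dots> \<le> q (x + t *\<^sub>R a) + q (- x)" using q by (rule sublinear_add)
      finally show "- q (- x) \<le> h t x" by (simp add: h_def)
    qed
    have low: "(INF t\<in>{0..}. h t x) \<le> h t x" if "t \<ge> 0" for t x
      using bdd by (rule cINF_lower) (use that in simp)
    have "sublinear (\<lambda>x. INF t\<in>{0..}. h t x)"
    proof (rule sublinear_INF[OF _ bdd])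
      fix s t :: real and x y :: 'a assume st: "s \<in> {0..}" "t \<in> {0..}"
      have "q (x + y + (s + t) *\<^sub>R a) = q ((x + s *\<^sub>R a) + (y + t *\<^sub>R a))"
        by (simp add: algebra_simps)
      also have "\<dots> \<le> q (x + s *\<^sub>R a) + q (y + t *\<^sub>R a)" using q by (rule sublinear_add)
      finally have "h (s + t) (x + y) \<le> h s x + h t y" by (simp add: h_def algebra_simps)
      with st show "\<exists>k\<in>{0..}. h k (x + y) \<le> h s x + h t y" by (intro bexI[of _ "s + t"]) auto
    next
      fix s t :: real and x :: 'a assume st: "s \<in> {0..}" "t > 0"
      have "h (t * s) (t *\<^sub>R x) = t * h s x"
        using sublinear_scale[OF q, of t "x + s *\<^sub>R a"] st by (simp add: h_def algebra_simps)
      with st show "\<exists>k\<in>{0..}. h k (t *\<^sub>R x) \<le> t * h s x" by (intro bexI[of _ "t * s"]) auto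
    qed simp
    moreover have "(INF t\<in>{0..}. h t x) \<le> q x" for x
      using low[of 0 x] by (simp add: h_def)
    ultimately have "(\<lambda>x. INF t\<in>{0..}. h t x) = q" by (rule min)
    then have "q x \<le> h 1 x" using low[of 1 x] by (metis zero_le_one)
    then show ?thesis by (simp add: h_def)
  qed
  have add: "q (x + y) = q x + q y" for x y
    using superadd[of x y] sublinear_add[OF q, of x y] by linarith
  have neg: "q (- x) = - q x" for x
    using add[of x "- x"] sublinear_zero[OF q] by simp
  have "q (t *\<^sub>R x) = t * q x" for t x
  proof (cases "t \<ge> 0")
    case True
    then show ?thesis using q by (simp add: sublinear_scale)
  next
    case False
    then have "q ((- t) *\<^sub>R x) = (- t) * q x" using q by (intro sublinear_scale) auto
    then show ?thesis using neg[of "t *\<^sub>R x"] by simp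
  qed
  with add show ?thesis by (intro linearI) auto
qed

text \<open>The functional is obtained below the sublinear functional
\<open>p v = inf {norm (v + t *\<^sub>R k) - t * d | t \<ge> 0, k \<in> K}\<close>. The choice \<open>t = 0\<close> gives \<open>p \<le> norm\<close>, the
choice \<open>v = - k\<close>, \<open>t = 1\<close> gives \<open>p (- k) \<le> - d\<close>, and \<open>norm k \<ge> d\<close> on \<open>K\<close> keeps the infimum finite.
For singletons this yields norming functionals.\<close>

lemma separation_from_origin:
  fixes K :: "'a::real_normed_vector set"
  assumes "convex K" "K \<noteq> {}" and d: "\<And>k. k \<in> K \<Longrightarrow> d \<le> norm k"
  obtains \<phi> :: "'a \<Rightarrow>\<^sub>L real" where "norm \<phi> \<le> 1" "\<And>k. k \<in> K \<Longrightarrow> d \<le> \<phi> k"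
proof -
  define h :: "real \<times> 'a \<Rightarrow> 'a \<Rightarrow> real"
    where "h = (\<lambda>(t, k) v. norm (v + t *\<^sub>R k) - t * d)"
  define p where "p v = (INF i\<in>{0..} \<times> K. h i v)" for v
  have bdd: "bdd_below ((\<lambda>i. h i v) ` ({0..} \<times> K))" for v
  proof (rule bdd_belowI2)
    fix i :: "real \<times> 'a" assume "i \<in> {0..} \<times> K"
    then obtain t k where i: "i = (t, k)" "t \<ge> 0" "k \<in> K" by auto
    have "t * d \<le> norm (t *\<^sub>R k)" using i d by (simp add: mult_left_mono)
    moreover have "norm (t *\<^sub>R k) \<le> norm (v + t *\<^sub>R k) + norm v"
      using norm_triangle_ineq4[of "v + t *\<^sub>R k" v] by simp
    ultimately show "- norm v \<le> h i v" by (simp add: i h_def)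
  qed
  have low: "p v \<le> norm (v + t *\<^sub>R k) - t * d" if "t \<ge> 0" "k \<in> K" for v t k
    using cINF_lower[OF bdd, of "(t, k)" v] that by (simp add: p_def h_def)
  have "sublinear p"
    unfolding p_def
  proof (rule sublinear_INF[OF _ bdd])
    from \<open>K \<noteq> {}\<close> obtain k where "k \<in> K" by blast
    then have "(0::real, k) \<in> {0..} \<times> K" by simp
    then show "{0::real..} \<times> K \<noteq> {}" by (metis empty_iff)
    fix i j :: "real \<times> 'a" and x y :: 'a assume "i \<in> {0..} \<times> K" "j \<in> {0..} \<times> K"
    then obtain s k t l where ij: "i = (s, k)" "j = (t, l)" "s \<ge> 0" "t \<ge> 0" "k \<in> K" "l \<in> K"
      by auto
    \<comment> \<open>Convexity merges the two rays: \<open>m\<close> is the weighted mean of \<open>k\<close> and \<open>l\<close>.\<close>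
    obtain m where m: "m \<in> K" "(s + t) *\<^sub>R m = s *\<^sub>R k + t *\<^sub>R l"
    proof (cases "s + t = 0")
      case True
      with ij that[of k] show ?thesis by (simp add: add_nonneg_eq_0_iff)
    next
      case False
      with ij have "s + t > 0" by simp
      have "(s / (s + t)) *\<^sub>R k + (t / (s + t)) *\<^sub>R l \<in> K"
        using ij \<open>s + t > 0\<close>
        by (intro convexD[OF \<open>convex K\<close>]) (auto simp flip: add_divide_distrib)
      moreover have "(s + t) *\<^sub>R ((s / (s + t)) *\<^sub>R k + (t / (s + t)) *\<^sub>R l) = s *\<^sub>R k + t *\<^sub>R l"
        using False by (simp add: scaleR_add_right)
      ultimately show ?thesis by (rule that)
    qed
    have "norm (x + y + (s + t) *\<^sub>R m) = norm ((x + s *\<^sub>R k) + (y + t *\<^sub>R l))"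
      unfolding m(2) by (simp add: algebra_simps)
    also have "\<dots> \<le> norm (x + s *\<^sub>R k) + norm (y + t *\<^sub>R l)" by (rule norm_triangle_ineq)
    finally have "h (s + t, m) (x + y) \<le> h i x + h j y"
      by (simp add: ij h_def algebra_simps)
    with ij m show "\<exists>k\<in>{0..} \<times> K. h k (x + y) \<le> h i x + h j y"
      by (intro bexI[of _ "(s + t, m)"]) auto
  next
    fix i :: "real \<times> 'a" and t :: real and x :: 'a assume "i \<in> {0..} \<times> K" "t > 0"
    then obtain s k where i: "i = (s, k)" "s \<ge> 0" "k \<in> K" "t > 0" by auto
    have "norm (t *\<^sub>R x + (t * s) *\<^sub>R k) = norm (t *\<^sub>R (x + s *\<^sub>R k))"
      by (simp add: scaleR_add_right)
    also have "\<dots> = t * norm (x + s *\<^sub>R k)" using i by simp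
    finally have "h (t * s, k) (t *\<^sub>R x) = t * h i x"
      using i by (simp add: h_def right_diff_distrib)
    with i show "\<exists>k\<in>{0..} \<times> K. h k (t *\<^sub>R x) \<le> t * h i x"
      by (intro bexI[of _ "(t * s, k)"]) auto
  qed
  then obtain q where q: "sublinear q" "\<And>x. q x \<le> p x"
    and "\<And>r. sublinear r \<Longrightarrow> (\<And>x. r x \<le> q x) \<Longrightarrow> r = q"
    using minimal_sublinear_exists by blast
  then have lin: "linear q" by (intro minimal_sublinear_imp_linear) auto
  have qn: "q v \<le> norm v" for v
    using low[of 0 _ v] q(2)[of v] assms(2) by fastforce
  have abs: "\<bar>q v\<bar> \<le> norm v" for v
    using qn[of v] qn[of "- v"] linear_neg[OF lin, of v] by auto
  have "bounded_linear q"
    using lin abs by (intro bounded_linear_intro[where K = 1]) (auto simp: linear_add linear_scale)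
  then have ap: "blinfun_apply (Blinfun q) = q" by (rule bounded_linear_Blinfun_apply)
  show thesis
  proof (rule that[of "Blinfun q"])
    show "norm (Blinfun q) \<le> 1" by (rule norm_blinfun_bound) (auto simp: ap abs)
    fix k assume "k \<in> K"
    then have "q (- k) \<le> - d" using low[of 1 k "- k"] q(2)[of "- k"] by simp
    then show "d \<le> Blinfun q k" by (simp add: ap linear_neg[OF lin])
  qed
qed

lemma norming_functional:
  fixes x :: "'a::real_normed_vector"
  obtains \<phi> :: "'a \<Rightarrow>\<^sub>L real" where "norm \<phi> \<le> 1" "norm x \<le> \<phi> x"
  using separation_from_origin[of "{x}" "norm x"] by auto

lemma separation_from_point:
  fixes K :: "'a::real_normed_vector set"
  assumes "convex K" "K \<noteq> {}" "x \<notin> closure K"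
  obtains \<phi> :: "'a \<Rightarrow>\<^sub>L real" and d where "d > 0" "norm \<phi> \<le> 1" "\<And>k. k \<in> K \<Longrightarrow> \<phi> x + d \<le> \<phi> k"
proof -
  from assms(3) obtain d where d: "d > 0" "\<And>k. k \<in> K \<Longrightarrow> d \<le> dist k x"
    unfolding closure_approachable by (auto simp: not_less)
  have "convex ((\<lambda>k. k - x) ` K)" using assms(1) by (simp add: convex_translation_subtract_eq)
  then obtain \<phi> :: "'a \<Rightarrow>\<^sub>L real" where \<phi>: "norm \<phi> \<le> 1" "\<And>k. k \<in> (\<lambda>k. k - x) ` K \<Longrightarrow> d \<le> \<phi> k"
    by (rule separation_from_origin[where d = d]) (use assms d in \<open>auto simp: dist_norm\<close>)
  have "\<phi> x + d \<le> \<phi> k" if "k \<in> K" for k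
    using \<phi>(2)[of "k - x"] that by (auto simp: blinfun.diff_right)
  with d \<phi> show thesis by (intro that[of d \<phi>]) auto
qed

text \<open>Mazur's theorem: a functional separating \<open>x\<close> from the hull would not converge along \<open>y\<close> to its
value at \<open>x\<close>.\<close>

lemma weak_limit_in_closure_convex_hull:
  fixes x :: "'a::real_normed_vector"
  assumes lim: "\<And>\<phi> :: 'a \<Rightarrow>\<^sub>L real. (\<lambda>n. \<phi> (y n)) \<longlonglongrightarrow> \<phi> x"
    and ev: "eventually (\<lambda>n. y n \<in> A) sequentially"
  shows "x \<in> closure (convex hull A)"
proof (rule ccontr)
  assume x: "x \<notin> closure (convex hull A)"
  have ne: "convex hull A \<noteq> {}" using eventually_happens[OF ev] by auto
  obtain \<phi> :: "'a \<Rightarrow>\<^sub>L real" and d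
    where d: "d > 0" "\<And>k. k \<in> convex hull A \<Longrightarrow> \<phi> x + d \<le> \<phi> k"
    by (rule separation_from_point[OF convex_convex_hull ne x]) blast
  from ev have "eventually (\<lambda>n. \<phi> x + d \<le> \<phi> (y n)) sequentially"
    by (rule eventually_mono) (rule d(2)[OF hull_inc])
  then have "\<phi> x + d \<le> \<phi> x"
    by (intro tendsto_lowerbound[OF lim]) auto
  with d show False by simp
qed

lemma convex_functional_le: "convex {v. blinfun_apply \<phi> v \<le> (c::real)}"
proof -
  have "convex (blinfun_apply \<phi> -` {..c})"
    by (intro convex_linear_vimage bounded_linear.linear blinfun.bounded_linear_right convex_real_interval)
  then show ?thesis by (simp add: vimage_def)
qed

lemma convex_functional_ge: "convex {v. (c::real) \<le> blinfun_apply \<phi> v}"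
  using convex_functional_le[of "- \<phi>" "- c"] by (simp add: blinfun.minus_left)

lemma closed_functional_ge: "closed {v. (c::real) \<le> blinfun_apply \<phi> v}"
  by (intro closed_Collect_le continuous_intros)

section \<open>Weakly compact sets have the fixed point property\<close>

lemma openin_weak_halfspace:
  fixes \<phi> :: "'a::real_normed_vector \<Rightarrow>\<^sub>L real"
  shows "openin weak_topology {v. blinfun_apply \<phi> v < c}"
proof -
  have "open {G :: ('a \<Rightarrow>\<^sub>L real) \<Rightarrow> real. G \<phi> < c}"
    by (intro open_Collect_less continuous_intros) auto
  then show ?thesis
    unfolding weak_topology_def openin_pullback_topology
    by (intro exI[of _ "{G. G \<phi> < c}"]) auto
qed

lemma closedin_weak_topology:
  assumes "closed K" "convex K"
  shows "closedin weak_topology K"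
proof (cases "K = {}")
  case False
  have UNIV: "topspace weak_topology = (UNIV :: 'a set)"
    by (simp add: weak_topology_def topspace_pullback_topology)
  have "\<exists>T. openin weak_topology T \<and> x \<in> T \<and> T \<subseteq> UNIV - K" if "x \<in> UNIV - K" for x
  proof -
    from that assms(1) have "x \<notin> closure K" by simp
    then obtain \<phi> :: "'a \<Rightarrow>\<^sub>L real" and d where "d > 0" "\<And>k. k \<in> K \<Longrightarrow> \<phi> x + d \<le> \<phi> k"
      by (rule separation_from_point[OF assms(2) False]) blast
    then show ?thesis
      by (intro exI[of _ "{v. blinfun_apply \<phi> v < \<phi> x + d}"])
        (auto intro: openin_weak_halfspace simp: not_less[symmetric])
  qed
  then have "openin weak_topology (UNIV - K)"
    by (subst openin_subopen) blast
  then show ?thesis by (simp add: closedin_def UNIV)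
qed simp

text \<open>An affine map commutes with averages, so applying \<open>f\<close> to the average of the first points of an orbit
shifts the orbit by one step, and only the two end points survive in the difference.\<close>

lemma affine_map_on_orbit_average:
  fixes f :: "'a::real_normed_vector \<Rightarrow> 'a"
  assumes K: "convex K" and f: "affine_map_on K f" "f ` K \<subseteq> K" and x: "x \<in> K"
  defines "z \<equiv> \<lambda>n. (1 / real (Suc n)) *\<^sub>R (\<Sum>k\<le>n. (f ^^ k) x)"
  shows "z n \<in> K" and "f (z n) - z n = (1 / real (Suc n)) *\<^sub>R ((f ^^ Suc n) x - x)"
proof -
  have orbit: "(f ^^ k) x \<in> K" for k
    by (induction k) (use x f(2) in auto)
  have "z n \<in> K \<and> f (z n) = (1 / real (Suc n)) *\<^sub>R (\<Sum>k\<le>n. (f ^^ Suc k) x)"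
  proof (induction n)
    case 0
    then show ?case using x by (simp add: z_def)
  next
    case (Suc n)
    define t where "t = real (Suc n) / real (Suc (Suc n))"
    have t: "t \<in> {0..1}" "1 - t = 1 / real (Suc (Suc n))" "t * (1 / real (Suc n)) = 1 / real (Suc (Suc n))"
      by (auto simp: t_def field_simps)
    have split: "(1 / real (Suc (Suc n))) *\<^sub>R (s + v) = t *\<^sub>R ((1 / real (Suc n)) *\<^sub>R s) + (1 - t) *\<^sub>R v" for s v :: 'a
      unfolding scaleR_scaleR t(2,3) by (simp add: scaleR_add_right)
    have z: "z (Suc n) = t *\<^sub>R z n + (1 - t) *\<^sub>R (f ^^ Suc n) x"
      unfolding z_def by (subst split[symmetric]) simp
    have "z (Suc n) \<in> K"
      unfolding z using Suc orbit[of "Suc n"] t(1) by (intro convexD[OF K]) auto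
    moreover have "f (z (Suc n)) = t *\<^sub>R f (z n) + (1 - t) *\<^sub>R f ((f ^^ Suc n) x)"
      unfolding z using f(1) Suc orbit[of "Suc n"] t(1) unfolding affine_map_on_def by blast
    moreover have "\<dots> = (1 / real (Suc (Suc n))) *\<^sub>R ((\<Sum>k\<le>n. (f ^^ Suc k) x) + f ((f ^^ Suc n) x))"
      using Suc by (simp only: split)
    ultimately show ?case by simp
  qed
  moreover have "(\<Sum>k\<le>n. (f ^^ Suc k) x - (f ^^ k) x) = (f ^^ Suc n) x - x"
    by (induction n) auto
  ultimately show "z n \<in> K" and "f (z n) - z n = (1 / real (Suc n)) *\<^sub>R ((f ^^ Suc n) x - x)"
    unfolding z_def
    by (simp_all add: scaleR_diff_right[symmetric] sum_subtractf[symmetric] del: funpow.simps)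
qed

text \<open>The sets \<open>D n\<close> of almost fixed points are weakly closed by convexity, nonempty by averaging over an
orbit, and decreasing.\<close>

lemma weakly_compact_imp_affine_fixed_point:
  fixes C :: "'a::banach set"
  assumes C: "compactin weak_topology C" and K: "K \<in> bounded_closed_convex_subsets C"
    and f: "affine_map_on K f" "f ` K \<subseteq> K" "continuous_on K f"
  shows "\<exists>x\<in>K. f x = x"
proof -
  from K have KC: "K \<subseteq> C" "K \<noteq> {}" "bounded K" "closed K" "convex K"
    by (auto simp: bounded_closed_convex_subsets_def)
  define D where "D n = {x\<in>K. norm (f x - x) \<le> inverse (Suc n)}" for n
  have "closed (D n)" for n
  proof -
    have "closed {x\<in>K. (\<lambda>x. norm (f x - x)) x \<in> {..inverse (Suc n)}}"
      using KC(4) f(3) by (intro continuous_closed_preimage[unfolded vimage_def Int_def, simplified] continuous_intros) auto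
    then show ?thesis by (simp add: D_def)
  qed
  moreover have "convex (D n)" for n
  proof (rule convexI)
    fix x y and u v :: real
    assume xy: "x \<in> D n" "y \<in> D n" and uv: "u \<ge> 0" "v \<ge> 0" "u + v = 1"
    then have "v = 1 - u" and u: "u \<in> {0..1}" by auto
    have xyK: "x \<in> K" "y \<in> K" using xy by (auto simp: D_def)
    have "f (u *\<^sub>R x + v *\<^sub>R y) = u *\<^sub>R f x + v *\<^sub>R f y"
      using f(1) u xyK unfolding affine_map_on_def \<open>v = 1 - u\<close> by blast
    then have "norm (f (u *\<^sub>R x + v *\<^sub>R y) - (u *\<^sub>R x + v *\<^sub>R y)) = norm (u *\<^sub>R (f x - x) + v *\<^sub>R (f y - y))"
      by (simp add: algebra_simps)
    also have "\<dots> \<le> u * norm (f x - x) + v * norm (f y - y)"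
      using norm_triangle_ineq[of "u *\<^sub>R (f x - x)" "v *\<^sub>R (f y - y)"] uv by simp
    also have "\<dots> \<le> inverse (Suc n)"
      using xy uv by (intro convex_bound_le) (auto simp: D_def)
    finally show "u *\<^sub>R x + v *\<^sub>R y \<in> D n"
      using xyK uv KC(5) by (auto simp: D_def intro: convexD)
  qed
  ultimately have cl: "closedin weak_topology (D n)" for n
    by (intro closedin_weak_topology)
  have D_mono: "D n \<subseteq> D m" if "m \<le> n" for m n
  proof -
    have "inverse (real (Suc n)) \<le> inverse (Suc m)" using that by (intro le_imp_inverse_le) auto
    then show ?thesis unfolding D_def using order_trans by blast
  qed
  have D_ne: "D n \<noteq> {}" for n
  proof -
    from KC obtain x M where x: "x \<in> K" and M: "\<And>k. k \<in> K \<Longrightarrow> norm k \<le> M" 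
      by (auto simp: bounded_iff)
    have orbit: "(f ^^ k) x \<in> K" for k
      by (induction k) (use x f(2) in auto)
    \<comment> \<open>The average moves by at most \<open>2 * M / (m + 1)\<close>.\<close>
    obtain m where m: "2 * M * real (Suc n) \<le> real (Suc m)"
      using real_arch_simple[of "2 * M * real (Suc n)"] by (metis of_nat_Suc add_increasing2 zero_le_one add.commute)
    define z where "z = (1 / real (Suc m)) *\<^sub>R (\<Sum>k\<le>m. (f ^^ k) x)"
    note av = affine_map_on_orbit_average[OF KC(5) f(1,2) x, of m, folded z_def]
    have "norm (f z - z) = norm ((f ^^ Suc m) x - x) / real (Suc m)"
      unfolding av(2) by simp
    also have "\<dots> \<le> (M + M) / real (Suc m)"
      using norm_triangle_ineq4[of "(f ^^ Suc m) x" x] M[OF orbit[of "Suc m"]] M[OF x]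
      by (intro divide_right_mono) auto
    also have "\<dots> \<le> inverse (Suc n)" using m by (simp add: field_simps)
    finally show ?thesis using av(1) by (auto simp: D_def)
  qed
  have "C \<inter> \<Inter> (range D) \<noteq> {}"
  proof -
    have "C \<inter> \<Inter> \<F> \<noteq> {}" if "finite \<F>" "\<F> \<subseteq> range D" for \<F>
    proof -
      from that obtain I where I: "finite I" "\<F> = D ` I" by (meson finite_subset_image)
      obtain m where "\<forall>i\<in>I. i \<le> m" using I(1) finite_nat_set_iff_bounded_le by blast
      then have "D m \<subseteq> \<Inter> \<F>" using D_mono I(2) by blast
      moreover have "D m \<subseteq> C" using KC(1) by (auto simp: D_def)
      ultimately show ?thesis using D_ne[of m] by blast
    qed
    with C cl show ?thesis unfolding compactin_fip by blast
  qed
  then obtain x where x: "x \<in> D n" for n by blast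
  have "norm (f x - x) \<le> 0"
    by (rule LIMSEQ_le_const[OF LIMSEQ_inverse_real_of_nat]) (use x in \<open>auto simp: D_def\<close>)
  with x[of 0] show ?thesis by (auto simp: D_def)
qed

section \<open>Functionals on the dual that are not evaluations\<close>

text \<open>The evaluations at points form a closed subspace of the bidual, because the space is complete. So a
functional on the dual that is not an evaluation has a positive distance to all of them; \<open>d\<close> is any
smaller number.\<close>

lemma distance_from_evaluations:
  fixes F :: "('a::banach \<Rightarrow>\<^sub>L real) \<Rightarrow> real"
  assumes F: "linear F" and not_ev: "\<And>z. \<exists>\<phi>. F \<phi> \<noteq> blinfun_apply \<phi> z"
  obtains d where "d > 0" "\<And>z. \<exists>\<phi>. norm \<phi> \<le> 1 \<and> d < F \<phi> - blinfun_apply \<phi> z"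
proof -
  have "\<exists>d>0. \<forall>z. \<exists>\<phi>. norm \<phi> \<le> 1 \<and> d < F \<phi> - blinfun_apply \<phi> z"
  proof (rule ccontr)
    assume "\<not> ?thesis"
    then have "\<exists>z. \<forall>\<phi>. norm \<phi> \<le> 1 \<longrightarrow> F \<phi> - blinfun_apply \<phi> z \<le> d" if "d > 0" for d
      using that by (meson not_less)
    then have "\<exists>z. \<forall>\<phi>. norm \<phi> \<le> 1 \<longrightarrow> F \<phi> - blinfun_apply \<phi> z \<le> inverse (Suc n)" for n
      by simp
    then obtain z where "\<And>n \<phi>. norm \<phi> \<le> 1 \<Longrightarrow> F \<phi> - blinfun_apply \<phi> (z n) \<le> inverse (Suc n)"
      by metis
    note z1 = this
    have z: "\<bar>F \<phi> - blinfun_apply \<phi> (z n)\<bar> \<le> inverse (Suc n)" if "norm \<phi> \<le> 1" for n \<phi>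
      using z1[of \<phi> n] z1[of "- \<phi>" n] that linear_neg[OF F, of \<phi>]
      by (simp add: blinfun.minus_left)
    have "Cauchy z"
    proof (rule CauchyI)
      fix e :: real assume "e > 0"
      then obtain N where N: "inverse (Suc N) < e / 2" using reals_Archimedean[of "e / 2"] by auto
      have "norm (z m - z n) < e" if "m \<ge> N" "n \<ge> N" for m n
      proof -
        obtain \<phi> :: "'a \<Rightarrow>\<^sub>L real" where \<phi>: "norm \<phi> \<le> 1" "norm (z m - z n) \<le> \<phi> (z m - z n)"
          by (rule norming_functional)
        have "inverse (real (Suc m)) \<le> inverse (Suc N)" "inverse (real (Suc n)) \<le> inverse (Suc N)"
          using that by (auto intro!: le_imp_inverse_le)
        with z[OF \<phi>(1), of m] z[OF \<phi>(1), of n] \<phi>(2) N show ?thesis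
          unfolding blinfun.diff_right by linarith
      qed
      then show "\<exists>N. \<forall>m\<ge>N. \<forall>n\<ge>N. norm (z m - z n) < e" by blast
    qed
    then obtain z0 where z0: "z \<longlonglongrightarrow> z0" using Cauchy_convergent convergent_def by blast
    have ball: "F \<phi> = blinfun_apply \<phi> z0" if "norm \<phi> \<le> 1" for \<phi>
    proof -
      have "(\<lambda>n. F \<phi> - blinfun_apply \<phi> (z n)) \<longlonglongrightarrow> 0"
        by (rule Lim_null_comparison[OF _ LIMSEQ_inverse_real_of_nat])
          (use z[OF that] in auto)
      moreover have "(\<lambda>n. F \<phi> - blinfun_apply \<phi> (z n)) \<longlonglongrightarrow> F \<phi> - blinfun_apply \<phi> z0"
        by (intro tendsto_intros z0)
      ultimately show ?thesis using LIMSEQ_unique by fastforce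
    qed
    from not_ev[of z0] obtain \<phi> where \<phi>: "F \<phi> \<noteq> blinfun_apply \<phi> z0" by blast
    then have "\<phi> \<noteq> 0" using ball[of 0] by auto
    then have "F \<phi> = norm \<phi> * F (\<phi> /\<^sub>R norm \<phi>)" using linear_scale[OF F, of _ \<phi>] by simp
    also have "\<dots> = norm \<phi> * blinfun_apply (\<phi> /\<^sub>R norm \<phi>) z0" by (subst ball) (use \<open>\<phi> \<noteq> 0\<close> in auto)
    also have "\<dots> = blinfun_apply \<phi> z0" using \<open>\<phi> \<noteq> 0\<close> by (simp add: blinfun.scaleR_left)
    finally show False using \<phi> by simp
  qed
  then show thesis using that by blast
qed

text \<open>The points \<open>(g \<phi>, v \<phi>)\<close> with \<open>\<phi> \<in> B\<close> form a convex subset of the plane. If it missed the strip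
\<open>{d<..} \<times> {-\<eta><..<\<eta>}\<close>, then a line would separate the two; this line is not horizontal since
\<open>0 \<in> B\<close>, so it would bound some \<open>g + c * v\<close> by \<open>d\<close> on \<open>B\<close>.\<close>

lemma large_on_one_small_on_other:
  fixes g v :: "'v::real_vector \<Rightarrow> real"
  assumes B: "convex B" "0 \<in> B" and g: "linear g" and v: "linear v" and "\<eta> > 0"
    and large: "\<And>c. \<exists>\<phi>\<in>B. d < g \<phi> + c * v \<phi>"
  shows "\<exists>\<phi>\<in>B. d < g \<phi> \<and> \<bar>v \<phi>\<bar> < \<eta>"
proof (rule ccontr)
  assume none: "\<not> ?thesis"
  define S where "S = (\<lambda>\<phi>. (g \<phi>, v \<phi>)) ` B"
  define T where "T = {d<..} \<times> {-\<eta><..<\<eta>}"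
  have "linear (\<lambda>\<phi>. (g \<phi>, v \<phi>))"
    using g v by (auto intro!: linearI simp: linear_add linear_scale)
  then have "convex S" unfolding S_def using B by (intro convex_linear_image)
  moreover have "convex T" unfolding T_def by (intro convex_Times convex_real_interval)
  moreover have "S \<noteq> {}" using B by (auto simp: S_def)
  moreover have "(d + 1, 0) \<in> T" using \<open>\<eta> > 0\<close> by (auto simp: T_def)
  then have "T \<noteq> {}" by blast
  moreover have "S \<inter> T = {}" using none by (auto simp: S_def T_def abs_less_iff)
  ultimately obtain a b where ab: "a \<noteq> 0" "\<forall>x\<in>S. a \<bullet> x \<le> b" "\<forall>x\<in>T. b \<le> a \<bullet> x"
    using separating_hyperplane_sets[of S T] by auto
  obtain a1 a2 where a: "a = (a1, a2)" by (cases a)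
  have S: "a1 * g \<phi> + a2 * v \<phi> \<le> b" if "\<phi> \<in> B" for \<phi>
    using ab(2) that by (auto simp: S_def a)
  have T: "b \<le> a1 * x + a2 * y" if "x > d" "\<bar>y\<bar> < \<eta>" for x y
    using ab(3) that by (auto simp: T_def a abs_less_iff)
  \<comment> \<open>As \<open>0 \<in> B\<close>, the separating level is nonnegative, which forces \<open>a1 \<ge> 0\<close> and excludes \<open>a1 = 0\<close>.\<close>
  have "b \<ge> 0" using S[OF B(2)] by (simp add: linear_0[OF g] linear_0[OF v])
  have "d < \<bar>d\<bar> + 1" by linarith
  then have "0 \<le> a1 * (\<bar>d\<bar> + 1)" using T[of "\<bar>d\<bar> + 1" 0] \<open>b \<ge> 0\<close> \<open>\<eta> > 0\<close> by simp
  moreover have "\<bar>d\<bar> + 1 > 0" by linarith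
  ultimately have "a1 \<ge> 0" by (simp add: zero_le_mult_iff)
  show False
  proof (cases "a1 = 0")
    case True
    have "0 \<le> a2 * (\<eta> / 2)" "0 \<le> a2 * (- \<eta> / 2)"
      using T[of "d + 1" "\<eta> / 2"] T[of "d + 1" "- \<eta> / 2"] \<open>b \<ge> 0\<close> \<open>\<eta> > 0\<close> True by auto
    then have "a2 = 0" using \<open>\<eta> > 0\<close> by (simp add: zero_le_mult_iff mult_le_0_iff)
    with True ab(1) a show False by (simp add: zero_prod_def)
  next
    case False
    with \<open>a1 \<ge> 0\<close> have "a1 > 0" by simp
    \<comment> \<open>Normalizing the first coefficient to \<open>1\<close> contradicts the hypothesis for \<open>c = a2 / a1\<close>.\<close>
    from large[of "a2 / a1"] obtain \<phi> where \<phi>: "\<phi> \<in> B" "d < g \<phi> + a2 / a1 * v \<phi>" by blast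
    define X where "X = g \<phi> + a2 / a1 * v \<phi>"
    have "a1 * X \<le> b" using S[OF \<phi>(1)] \<open>a1 > 0\<close> by (simp add: X_def distrib_left)
    also have "b \<le> a1 * ((d + X) / 2)" using T[of "(d + X) / 2" 0] \<phi>(2) \<open>\<eta> > 0\<close> by (simp add: X_def)
    finally have "X \<le> (d + X) / 2" using \<open>a1 > 0\<close> by (simp only: mult_le_cancel_left_pos)
    then have "X \<le> d" by (simp add: field_simps)
    with \<phi>(2)[folded X_def] show False by simp
  qed
qed

text \<open>Induction on the number of constraints: the part of \<open>B\<close> where the last constraint holds is again
convex, and the previous lemma carries the hypothesis over to it.\<close>

lemma large_on_one_small_on_finitely_many:
  fixes g :: "'v::real_vector \<Rightarrow> real" and v :: "nat \<Rightarrow> 'v \<Rightarrow> real"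
  assumes "convex B" "0 \<in> B" and g: "linear g" and v: "\<And>i. i < n \<Longrightarrow> linear (v i)" and "\<eta> > 0"
    and "\<And>c. \<exists>\<phi>\<in>B. d < g \<phi> + (\<Sum>i<n. c i * v i \<phi>)"
  shows "\<exists>\<phi>\<in>B. d < g \<phi> \<and> (\<forall>i<n. \<bar>v i \<phi>\<bar> < \<eta>)"
  using assms(1,2,4,6)
proof (induction n arbitrary: B)
  case 0
  then show ?case by simp
next
  case (Suc n)
  define B' where "B' = {\<phi>\<in>B. \<bar>v n \<phi>\<bar> < \<eta>}"
  have vn: "linear (v n)" using Suc.prems by simp
  have "B' = B \<inter> v n -` {-\<eta><..<\<eta>}" by (auto simp: B'_def)
  then have "convex B'"
    using Suc.prems(1) vn by (auto intro!: convex_Int convex_linear_vimage convex_real_interval)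
  moreover have "0 \<in> B'" using Suc.prems(2) \<open>\<eta> > 0\<close> by (simp add: B'_def linear_0[OF vn])
  moreover have "linear (v i)" if "i < n" for i using Suc.prems(3) that by simp
  moreover have "\<exists>\<phi>\<in>B'. d < g \<phi> + (\<Sum>i<n. c i * v i \<phi>)" for c
  proof -
    have "\<exists>\<phi>\<in>B. d < (g \<phi> + (\<Sum>i<n. c i * v i \<phi>)) \<and> \<bar>v n \<phi>\<bar> < \<eta>"
    proof (rule large_on_one_small_on_other)
      show "linear (\<lambda>\<phi>. g \<phi> + (\<Sum>i<n. c i * v i \<phi>))"
        using g Suc.prems(3)
        by (auto intro!: linearI simp: linear_add linear_scale algebra_simps sum.distrib sum_distrib_left)
      fix t
      \<comment> \<open>The free multiple of the last functional is its coefficient in the hypothesis.\<close>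
      from Suc.prems(4)[of "c(n := t)"] show "\<exists>\<phi>\<in>B. d < g \<phi> + (\<Sum>i<n. c i * v i \<phi>) + t * v n \<phi>"
        by (simp add: add.assoc)
    qed (use Suc.prems vn \<open>\<eta> > 0\<close> in auto)
    then show ?thesis by (auto simp: B'_def)
  qed
  ultimately have "\<exists>\<phi>\<in>B'. d < g \<phi> \<and> (\<forall>i<n. \<bar>v i \<phi>\<bar> < \<eta>)" by (rule Suc.IH)
  then show ?case by (auto simp: B'_def less_Suc_eq)
qed

text \<open>A form of Helly's theorem: a functional on the dual that stays away from all evaluations can be kept
large on the unit ball while finitely many evaluations are made small.\<close>

lemma functional_small_on_finitely_many_points:
  fixes F :: "('a::real_normed_vector \<Rightarrow>\<^sub>L real) \<Rightarrow> real" and a :: "nat \<Rightarrow> 'a"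
  assumes F: "linear F" and d: "\<And>z. \<exists>\<phi>. norm \<phi> \<le> 1 \<and> d < F \<phi> - blinfun_apply \<phi> z" and "\<eta> > 0"
  obtains \<phi> where "norm \<phi> \<le> 1" "d < F \<phi>" "\<And>i. i < n \<Longrightarrow> \<bar>blinfun_apply \<phi> (a i)\<bar> < \<eta>"
proof -
  have "\<exists>\<phi>\<in>cball 0 1. d < F \<phi> \<and> (\<forall>i<n. \<bar>blinfun_apply \<phi> (a i)\<bar> < \<eta>)"
  proof (rule large_on_one_small_on_finitely_many)
    fix c :: "nat \<Rightarrow> real"
    from d[of "- (\<Sum>i<n. c i *\<^sub>R a i)"]
    show "\<exists>\<phi>\<in>cball 0 1. d < F \<phi> + (\<Sum>i<n. c i * blinfun_apply \<phi> (a i))"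
      by (auto simp: blinfun.minus_right blinfun.sum_right blinfun.scaleR_right)
  qed (use F \<open>\<eta> > 0\<close> in \<open>auto intro!: linearI simp: blinfun.add_left blinfun.scaleR_left\<close>)
  then show thesis using that by auto
qed

section \<open>A sequence whose tail hulls have empty intersection\<close>

lemma convex_hull_image_finite:
  assumes "z \<in> convex hull (f ` I)"
  obtains J where "finite J" "J \<subseteq> I" "z \<in> convex hull (f ` J)"
proof -
  from assms obtain S where S: "finite S" "S \<subseteq> f ` I" "z \<in> convex hull S"
    unfolding convex_hull_explicit[of "f ` I"] by (auto simp: convex_hull_finite)
  then obtain J where "J \<subseteq> I" "finite J" "S = f ` J" by (meson finite_subset_image)
  with S show thesis by (intro that[of J]) auto
qed

text \<open>The weak topology makes evaluation an embedding of the space into the product of lines indexed by the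
dual. There the image of \<open>C\<close> lies in a compact cube, so it cannot be closed; \<open>F\<close> is any point of its
closure outside the image. A limit of evaluations is linear, and if \<open>F\<close> were the evaluation at \<open>z\<close>,
then \<open>z\<close> could not be separated from the closed convex set \<open>C\<close>.\<close>

lemma noncompact_imp_functional_outside:
  fixes C :: "'a::banach set"
  assumes "bounded C" "closed C" "convex C" "C \<noteq> {}" and nc: "\<not> compactin weak_topology C"
  obtains F :: "('a \<Rightarrow>\<^sub>L real) \<Rightarrow> real" where "linear F" "\<And>z. \<exists>\<phi>. F \<phi> \<noteq> blinfun_apply \<phi> z"
    "\<And>\<Phi> \<epsilon>. finite \<Phi> \<Longrightarrow> \<epsilon> > 0 \<Longrightarrow> \<exists>x\<in>C. \<forall>\<phi>\<in>\<Phi>. \<bar>blinfun_apply \<phi> x - F \<phi>\<bar> < \<epsilon>"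
proof -
  define ev :: "'a \<Rightarrow> ('a \<Rightarrow>\<^sub>L real) \<Rightarrow> real" where "ev x = (\<lambda>\<phi>. blinfun_apply \<phi> x)" for x
  have weak: "weak_topology = pullback_topology UNIV ev euclidean"
    unfolding weak_topology_def ev_def ..
  from \<open>bounded C\<close> obtain M where M: "\<And>x. x \<in> C \<Longrightarrow> norm x \<le> M" by (auto simp: bounded_iff)
  define P where "P = (\<Pi>\<^sub>E \<phi>\<in>UNIV. {- (M * norm \<phi>) .. M * norm (\<phi> :: 'a \<Rightarrow>\<^sub>L real)})"
  have "compact P"
    unfolding P_def compactin_euclidean_iff[symmetric] euclidean_product_topology[symmetric]
    unfolding compactin_PiE by (simp add: compactin_euclidean_iff)
  have CP: "ev ` C \<subseteq> P"
  proof -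
    have "\<bar>blinfun_apply \<phi> x\<bar> \<le> M * norm \<phi>" if "x \<in> C" for x and \<phi> :: "'a \<Rightarrow>\<^sub>L real"
      using norm_blinfun[of \<phi> x] mult_left_mono[OF M[OF that], of "norm \<phi>"] by (simp add: mult.commute)
    then show ?thesis by (auto simp: P_def ev_def abs_le_iff PiE_iff minus_le_iff)
  qed
  have "\<not> closed (ev ` C)"
  proof
    assume "closed (ev ` C)"
    with \<open>compact P\<close> have "compact (P \<inter> ev ` C)" by (rule compact_Int_closed)
    with CP have comp: "compact (ev ` C)" by (simp add: Int_absorb1)
    have "compactin weak_topology C"
      unfolding compactin_def
    proof (intro conjI allI impI)
      show "C \<subseteq> topspace weak_topology" by (simp add: weak topspace_pullback_topology)
      fix \<U> assume \<U>: "Ball \<U> (openin weak_topology) \<and> C \<subseteq> \<Union> \<U>"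
      then have "\<forall>U\<in>\<U>. \<exists>V. open V \<and> U = ev -` V"
        by (auto simp: weak openin_pullback_topology)
      then obtain V where V: "\<And>U. U \<in> \<U> \<Longrightarrow> open (V U) \<and> U = ev -` V U" by metis
      have "ev ` C \<subseteq> (\<Union>U\<in>\<U>. V U)" using \<U> V by blast
      from compactE_image[OF comp _ this] V
      obtain \<F> where \<F>: "\<F> \<subseteq> \<U>" "finite \<F>" "ev ` C \<subseteq> (\<Union>U\<in>\<F>. V U)" by metis
      then have "C \<subseteq> \<Union> \<F>" using V by blast
      with \<F> show "\<exists>\<F>. finite \<F> \<and> \<F> \<subseteq> \<U> \<and> C \<subseteq> \<Union> \<F>" by blast
    qed
    with nc show False ..
  qed
  then obtain F where F: "F \<in> closure (ev ` C)" "F \<notin> ev ` C"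
    using closure_subset_eq by blast
  have approx: "\<exists>x\<in>C. \<forall>\<phi>\<in>\<Phi>. \<bar>blinfun_apply \<phi> x - F \<phi>\<bar> < \<epsilon>"
    if "finite \<Phi>" "\<epsilon> > 0" for \<Phi> and \<epsilon> :: real
  proof -
    define V where "V = (\<Inter>\<phi>\<in>\<Phi>. (\<lambda>G. G \<phi>) -` ball (F \<phi>) \<epsilon>)"
    have "open V"
      unfolding V_def using that by (intro open_INT ballI open_vimage) auto
    moreover have "F \<in> V" using that by (simp add: V_def)
    ultimately have "V \<inter> ev ` C \<noteq> {}" using F(1) open_Int_closure_eq_empty[of V "ev ` C"] by blast
    then show ?thesis by (force simp: V_def ev_def dist_real_def abs_minus_commute)
  qed
  have lin: "linear F"
  proof (rule linearI)
    fix \<phi> \<psi>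
    show "F (\<phi> + \<psi>) = F \<phi> + F \<psi>"
    proof (rule ccontr)
      assume "F (\<phi> + \<psi>) \<noteq> F \<phi> + F \<psi>"
      define e where "e = \<bar>F (\<phi> + \<psi>) - (F \<phi> + F \<psi>)\<bar>"
      have "e > 0" using \<open>F (\<phi> + \<psi>) \<noteq> F \<phi> + F \<psi>\<close> by (simp add: e_def)
      then obtain x where "\<forall>\<theta>\<in>{\<phi>, \<psi>, \<phi> + \<psi>}. \<bar>blinfun_apply \<theta> x - F \<theta>\<bar> < e / 3"
        using approx[of "{\<phi>, \<psi>, \<phi> + \<psi>}" "e / 3"] by auto
      then have "\<bar>blinfun_apply \<phi> x - F \<phi>\<bar> < e / 3" "\<bar>blinfun_apply \<psi> x - F \<psi>\<bar> < e / 3"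
        "\<bar>blinfun_apply \<phi> x + blinfun_apply \<psi> x - F (\<phi> + \<psi>)\<bar> < e / 3"
        by (simp_all add: blinfun.add_left)
      moreover have "e \<le> \<bar>blinfun_apply \<phi> x - F \<phi>\<bar> + \<bar>blinfun_apply \<psi> x - F \<psi>\<bar>
          + \<bar>blinfun_apply \<phi> x + blinfun_apply \<psi> x - F (\<phi> + \<psi>)\<bar>"
        unfolding e_def by linarith
      ultimately show False by linarith
    qed
  next
    fix r \<phi>
    show "F (r *\<^sub>R \<phi>) = r *\<^sub>R F \<phi>"
    proof (rule ccontr)
      assume ne: "F (r *\<^sub>R \<phi>) \<noteq> r *\<^sub>R F \<phi>"
      define e where "e = \<bar>F (r *\<^sub>R \<phi>) - r * F \<phi>\<bar>"
      define e' where "e' = e / (2 * (1 + \<bar>r\<bar>))"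
      have "e > 0" using ne by (simp add: e_def)
      then have "e' > 0" by (simp add: e'_def add_pos_nonneg)
      then obtain x where x: "\<bar>blinfun_apply \<phi> x - F \<phi>\<bar> < e'" "\<bar>r * blinfun_apply \<phi> x - F (r *\<^sub>R \<phi>)\<bar> < e'"
        using approx[of "{\<phi>, r *\<^sub>R \<phi>}" e'] by (auto simp: blinfun.scaleR_left)
      have "\<bar>r * blinfun_apply \<phi> x - r * F \<phi>\<bar> = \<bar>r\<bar> * \<bar>blinfun_apply \<phi> x - F \<phi>\<bar>"
        by (simp flip: right_diff_distrib add: abs_mult)
      also have "\<dots> \<le> \<bar>r\<bar> * e'" using x(1) by (simp add: mult_left_mono)
      finally have "e \<le> e' + \<bar>r\<bar> * e'" using x(2) unfolding e_def by linarith
      also have "\<dots> = e / 2"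
      proof -
        have ne: "1 + \<bar>r\<bar> \<noteq> 0" by linarith
        have "e' + \<bar>r\<bar> * e' = (1 + \<bar>r\<bar>) * (e / (2 * (1 + \<bar>r\<bar>)))"
          unfolding e'_def by (simp only: distrib_right mult_1)
        also have "\<dots> = e / 2"
          using nonzero_mult_divide_mult_cancel_left[OF ne, of e 2] by (simp only: mult.commute times_divide_eq_right)
        finally show ?thesis .
      qed
      finally show False using \<open>e > 0\<close> by simp
    qed
  qed
  have not_ev: "\<exists>\<phi>. F \<phi> \<noteq> blinfun_apply \<phi> z" for z
  proof (rule ccontr)
    assume "\<nexists>\<phi>. F \<phi> \<noteq> blinfun_apply \<phi> z"
    then have Fz: "F = ev z" by (auto simp: ev_def)
    with F(2) have "z \<notin> closure C" using \<open>closed C\<close> by auto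
    then obtain \<phi> :: "'a \<Rightarrow>\<^sub>L real" and d where d: "d > 0" "\<And>k. k \<in> C \<Longrightarrow> \<phi> z + d \<le> \<phi> k"
      by (rule separation_from_point[OF \<open>convex C\<close> \<open>C \<noteq> {}\<close>]) blast
    from approx[of "{\<phi>}" d] d(1) obtain x where "x \<in> C" "\<bar>\<phi> x - \<phi> z\<bar> < d" by (auto simp: Fz ev_def)
    with d(2)[of x] show False by linarith
  qed
  show thesis by (rule that[OF lin not_ev approx])
qed

text \<open>James' construction. Functionals \<open>\<phi> n\<close> and points \<open>y n\<close> are chosen in turn so that \<open>\<phi> n\<close> is small on
the earlier points while \<open>F (\<phi> n) > d\<close>, and \<open>y n\<close> is so close to \<open>F\<close> on the functionals chosen so far
that these exceed \<open>d\<close> at \<open>y n\<close>. A point in all closed tail hulls is close to a combination of the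
first \<open>n\<close> points, where \<open>\<phi> n\<close> is small, but it is also in the hull of the others, where \<open>\<phi> n \<ge> d\<close>.\<close>

lemma noncompact_imp_empty_tail_intersection:
  fixes C :: "'a::banach set"
  assumes "bounded C" "closed C" "convex C" "C \<noteq> {}" "\<not> compactin weak_topology C"
  obtains y :: "nat \<Rightarrow> 'a" where "range y \<subseteq> C" "(\<Inter>p. closure (convex hull (y ` {p..}))) = {}"
proof -
  obtain F :: "('a \<Rightarrow>\<^sub>L real) \<Rightarrow> real" where F: "linear F" "\<And>z. \<exists>\<phi>. F \<phi> \<noteq> blinfun_apply \<phi> z"
    and approx: "\<And>\<Phi> \<epsilon>. finite \<Phi> \<Longrightarrow> \<epsilon> > 0 \<Longrightarrow> \<exists>x\<in>C. \<forall>\<phi>\<in>\<Phi>. \<bar>blinfun_apply \<phi> x - F \<phi>\<bar> < \<epsilon>"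
    by (rule noncompact_imp_functional_outside[OF assms]) blast
  obtain d where d: "d > 0" "\<And>z. \<exists>\<phi>. norm \<phi> \<le> 1 \<and> d < F \<phi> - blinfun_apply \<phi> z"
    by (rule distance_from_evaluations[OF F]) blast
  define P where "P h n r \<longleftrightarrow> (norm (fst r) \<le> 1 \<and> d < F (fst r) \<and> (\<forall>k<n. \<bar>blinfun_apply (fst r) (snd (h k))\<bar> < d / 3))
    \<and> (snd r \<in> C \<and> d < blinfun_apply (fst r) (snd r) \<and> (\<forall>k<n. d < blinfun_apply (fst (h k)) (snd r)))"
    for h :: "nat \<Rightarrow> ('a \<Rightarrow>\<^sub>L real) \<times> 'a" and n r
  have "\<exists>f. \<forall>n. P f n (f n)"
  proof (rule dependent_wellorder_choice)
    show "P f x r = P g x r" if "\<And>y. y < x \<Longrightarrow> f y = g y" for r f g x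
      using that by (auto simp: P_def)
    fix n f assume IH: "\<And>k. k < n \<Longrightarrow> P f k (f k)"
    obtain \<phi> where \<phi>: "norm \<phi> \<le> 1" "d < F \<phi>" "\<And>k. k < n \<Longrightarrow> \<bar>blinfun_apply \<phi> (snd (f k))\<bar> < d / 3"
      using functional_small_on_finitely_many_points[OF F(1) d(2), of "d / 3" n "\<lambda>k. snd (f k)"] d(1) by auto
    \<comment> \<open>Finitely many strict inequalities \<open>F \<theta> > d\<close> leave room for an approximation by a point of \<open>C\<close>.\<close>
    define \<Phi> where "\<Phi> = insert \<phi> ((\<lambda>k. fst (f k)) ` {..<n})"
    have fin: "finite \<Phi>" "\<Phi> \<noteq> {}" by (auto simp: \<Phi>_def)
    have "d < F \<theta>" if "\<theta> \<in> \<Phi>" for \<theta>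
      using that \<phi>(2) IH by (auto simp: \<Phi>_def P_def)
    then have "Min (F ` \<Phi>) - d > 0" using fin by simp
    then obtain x where x: "x \<in> C" "\<forall>\<theta>\<in>\<Phi>. \<bar>blinfun_apply \<theta> x - F \<theta>\<bar> < Min (F ` \<Phi>) - d"
      using approx fin by blast
    have "d < blinfun_apply \<theta> x" if "\<theta> \<in> \<Phi>" for \<theta>
    proof -
      have "Min (F ` \<Phi>) \<le> F \<theta>" using that fin by simp
      with x(2) that show ?thesis by fastforce
    qed
    then have "P f n (\<phi>, x)" using \<phi> x(1) by (auto simp: P_def \<Phi>_def)
    then show "\<exists>r. P f n r" ..
  qed
  then obtain f where f: "\<And>n. P f n (f n)" by blast
  define \<phi> where "\<phi> n = fst (f n)" for n
  define y where "y n = snd (f n)" for n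
  have yC: "y n \<in> C" and \<phi>n: "norm (\<phi> n) \<le> 1" for n
    using f[of n] by (auto simp: P_def \<phi>_def y_def)
  have small: "\<bar>\<phi> n (y k)\<bar> < d / 3" if "k < n" for k n
    using f[of n] that by (auto simp: P_def \<phi>_def y_def)
  have large: "d \<le> \<phi> n (y k)" if "n \<le> k" for k n
    using f[of k] that by (cases "n = k") (auto simp: P_def \<phi>_def y_def less_imp_le)
  have False if x: "\<And>p. x \<in> closure (convex hull (y ` {p..}))" for x
  proof -
    have "x \<in> closure (convex hull (range y))" using x[of 0] by (simp add: atLeast_0)
    then obtain z where z: "z \<in> convex hull (range y)" "dist z x < d / 3"
      using d(1) unfolding closure_approachable by (metis zero_less_divide_iff zero_less_numeral)
    obtain J where J: "finite J" "z \<in> convex hull (y ` J)"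
      using z(1) by (rule convex_hull_image_finite)
    obtain n where "J \<subseteq> {..<n}" using J(1) finite_nat_iff_bounded by blast
    then have "convex hull (y ` J) \<subseteq> convex hull (y ` {..<n})" by (intro hull_mono image_mono)
    with J(2) have n: "z \<in> convex hull (y ` {..<n})" by (rule subsetD[rotated])
    have "convex hull (y ` {..<n}) \<subseteq> {v. \<phi> n v \<le> d / 3}"
    proof (rule hull_minimal)
      show "convex {v. blinfun_apply (\<phi> n) v \<le> d / 3}" by (rule convex_functional_le)
    qed (use small[of _ n] in \<open>fastforce simp: abs_less_iff\<close>)
    then have 1: "\<phi> n z \<le> d / 3" using n by blast
    have "closure (convex hull (y ` {n..})) \<subseteq> {v. d \<le> \<phi> n v}"
    proof (intro closure_minimal hull_minimal convex_functional_ge closed_functional_ge)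
    qed (use large in auto)
    then have 2: "d \<le> \<phi> n x" using x by blast
    have "\<bar>\<phi> n (x - z)\<bar> \<le> norm (\<phi> n) * norm (x - z)" using norm_blinfun[of "\<phi> n" "x - z"] by simp
    also have "\<dots> \<le> 1 * norm (x - z)" by (intro mult_right_mono \<phi>n) auto
    also have "\<dots> < d / 3" using z(2) by (simp add: dist_norm norm_minus_commute)
    finally show False using 1 2 d(1) by (simp add: blinfun.diff_right abs_less_iff)
  qed
  then show thesis using yC by (intro that[of y]) auto
qed

lemma empty_tail_intersection_blocks:
  fixes y :: "nat \<Rightarrow> 'a::real_normed_vector"
  assumes "(\<Inter>p. closure (convex hull (y ` {p..}))) = {}" and w: "\<And>k. w k \<in> convex hull (y ` {k..})"
  shows "(\<Inter>p. closure (convex hull (w ` {p..}))) = {}"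
proof -
  have "convex hull (w ` {p..}) \<subseteq> convex hull (y ` {p..})" for p
  proof (rule hull_minimal)
    have "w k \<in> convex hull (y ` {p..})" if "p \<le> k" for k
    proof -
      have "y ` {k..} \<subseteq> y ` {p..}" using that by auto
      then show ?thesis using w[of k] hull_mono by blast
    qed
    then show "w ` {p..} \<subseteq> convex hull (y ` {p..})" by auto
  qed simp
  then have "(\<Inter>p. closure (convex hull (w ` {p..}))) \<subseteq> (\<Inter>p. closure (convex hull (y ` {p..})))"
    by (intro INF_mono' closure_mono)
  then show ?thesis using assms(1) by simp
qed

lemma empty_tail_intersection_subsequence:
  fixes y :: "nat \<Rightarrow> 'a::real_normed_vector"
  assumes "(\<Inter>p. closure (convex hull (y ` {p..}))) = {}" and r: "strict_mono (r :: nat \<Rightarrow> nat)"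
  shows "(\<Inter>p. closure (convex hull ((y \<circ> r) ` {p..}))) = {}"
  by (rule empty_tail_intersection_blocks[OF assms(1)]) (use seq_suble[OF r] in \<open>auto intro!: hull_inc\<close>)

section \<open>Shifts of sequences\<close>

text \<open>Coefficients indexed by initial segments of the naturals are convenient for shifting.\<close>

lemma span_range_eq_finite_sums:
  fixes w :: "nat \<Rightarrow> 'a::real_vector"
  assumes "x \<in> span (range w)"
  obtains n c where "x = (\<Sum>k<n. c k *\<^sub>R w k)"
proof -
  from assms have "\<exists>n c. x = (\<Sum>k<n. c k *\<^sub>R w k)"
  proof (induction rule: span_induct_alt)
    case base
    have "0 = (\<Sum>k<0. c k *\<^sub>R w k)" for c by simp
    then show ?case by blast
  next
    case (step a v y)
    then obtain j n c where j: "v = w j" and y: "y = (\<Sum>k<n. c k *\<^sub>R w k)" by blast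
    define m where "m = max n (Suc j)"
    have "(\<Sum>k<m. (if k < n then c k else 0) *\<^sub>R w k) = y"
      unfolding y by (rule sum.mono_neutral_cong_right) (auto simp: m_def)
    moreover have "(\<Sum>k<m. (if k = j then a else 0) *\<^sub>R w k) = (\<Sum>k<m. if k = j then a *\<^sub>R w k else 0)"
      by (rule sum.cong) auto
    then have "(\<Sum>k<m. (if k = j then a else 0) *\<^sub>R w k) = a *\<^sub>R v"
      by (simp add: j m_def less_max_iff_disj)
    ultimately have "a *\<^sub>R v + y = (\<Sum>k<m. ((if k < n then c k else 0) + (if k = j then a else 0)) *\<^sub>R w k)"
      by (simp only: scaleR_add_left sum.distrib add.commute)
    then show ?case by (intro exI)
  qed
  then show thesis using that by blast
qed

lemma independent_range_if_finite_sums_independent: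
  fixes w :: "nat \<Rightarrow> 'a::real_vector"
  assumes indep: "\<And>n c k. (\<Sum>k<n. c k *\<^sub>R w k) = 0 \<Longrightarrow> k < n \<Longrightarrow> c k = 0"
  shows "inj w" and "independent (range w)"
proof -
  show inj: "inj w"
  proof (rule injI, rule ccontr)
    fix i j assume ij: "w i = w j" "i \<noteq> j"
    define n where "n = Suc (max i j)"
    have delta: "(\<Sum>k<n. (if k = l then 1 else 0) *\<^sub>R w k) = w l" if "l < n" for l
    proof -
      have "(\<Sum>k<n. (if k = l then 1 else 0) *\<^sub>R w k) = (\<Sum>k<n. if k = l then w k else 0)"
        by (rule sum.cong) auto
      then show ?thesis using that by simp
    qed
    have "i < n" "j < n" by (auto simp: n_def)
    then have "(\<Sum>k<n. ((if k = i then 1 else 0) - (if k = j then 1 else 0)) *\<^sub>R w k) = 0"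
      using ij(1) unfolding scaleR_diff_left sum_subtractf by (simp only: delta diff_self)
    from indep[OF this \<open>i < n\<close>] ij(2) show False by simp
  qed
  show "independent (range w)"
  proof
    assume "dependent (range w)"
    then obtain t u v where t: "finite t" "t \<subseteq> range w" and
      u: "(\<Sum>v\<in>t. u v *\<^sub>R v) = 0" "v \<in> t" "u v \<noteq> 0"
      unfolding dependent_explicit by blast
    from t obtain I where I: "finite I" "t = w ` I" by (meson finite_subset_image)
    then obtain n where n: "I \<subseteq> {..<n}" using finite_nat_iff_bounded by blast
    have "(\<Sum>k<n. (if k \<in> I then u (w k) else 0) *\<^sub>R w k) = (\<Sum>k\<in>I. u (w k) *\<^sub>R w k)"
      using n by (intro sum.mono_neutral_cong_right) auto
    also have "\<dots> = 0"
      using u(1) inj_on_subset[OF inj, of I] by (simp add: I sum.reindex)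
    finally have *: "(\<Sum>k<n. (if k \<in> I then u (w k) else 0) *\<^sub>R w k) = 0" .
    from u(2) I obtain k where k: "k \<in> I" "v = w k" by blast
    with indep[OF *, of k] n u(3) show False by auto
  qed
qed

text \<open>The first hypothesis makes the shift well defined as a linear map \<open>g\<close>. On differences of points of the
convex hull \<open>H\<close> of the sequence, all iterates of \<open>g\<close> are bounded above and below by \<open>L\<close>. Hence \<open>g\<close>
extends from \<open>H\<close> to a Lipschitz map \<open>f\<close> of the closure \<open>K\<close>, and the bounds for the iterates and
affinity pass to the limit.\<close>

lemma shift_equivalent_imp_not_FPP:
  fixes w :: "nat \<Rightarrow> 'a::banach"
  assumes indep: "\<And>n c k. (\<Sum>k<n. c k *\<^sub>R w k) = 0 \<Longrightarrow> k < n \<Longrightarrow> c k = 0"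
    and upper: "\<And>p n c. norm (\<Sum>k<n. c k *\<^sub>R w (k + p)) \<le> L * norm (\<Sum>k<n. c k *\<^sub>R w k)"
    and lower: "\<And>p n c. norm (\<Sum>k<n. c k *\<^sub>R w k) \<le> L * norm (\<Sum>k<n. c k *\<^sub>R w (k + p))"
    and tails: "(\<Inter>p. closure (convex hull (w ` {p..}))) = {}"
    and C: "range w \<subseteq> C" "bounded C" "closed C" "convex C"
  shows "\<not> has_G_FPP C affine_uniformly_bilipschitz_maps"
proof -
  define H where "H = convex hull (range w)"
  define K where "K = closure H"
  have HK: "H \<subseteq> K" by (simp add: K_def closure_subset)
  have "w 0 \<noteq> 0" using indep[of "\<lambda>_. 1" 1 0] by auto
  moreover have "norm (w 0) \<le> L * norm (w 0)"
    using upper[where n = 1 and c = "\<lambda>_. 1" and p = 0] by simp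
  ultimately have L: "L \<ge> 0" using order_trans[OF norm_ge_zero] by (fastforce simp: zero_le_mult_iff)
  have inj: "inj w" by (rule independent_range_if_finite_sums_independent(1)[of w]) (rule indep)
  have ind: "independent (range w)"
    by (rule independent_range_if_finite_sums_independent(2)[of w]) (rule indep)
  from linear_independent_extend[OF ind, of "\<lambda>x. w (Suc (inv w x))"] inj
  obtain g where g: "linear g" "\<And>k. g (w k) = w (Suc k)" by auto
  have gp: "linear (g ^^ p)" for p
  proof (induction p)
    case 0
    show ?case using linear_ident by (simp add: id_def)
  next
    case (Suc p)
    then show ?case using linear_compose[OF Suc g(1)] by (simp add: o_def)
  qed
  have gpw: "(g ^^ p) (w k) = w (k + p)" for p k
    by (induction p) (auto simp: g)
  have gp_bounds: "norm ((g ^^ p) x) \<le> L * norm x" "norm x \<le> L * norm ((g ^^ p) x)"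
    if "x \<in> span (range w)" for x p
  proof -
    obtain n c where x: "x = (\<Sum>k<n. c k *\<^sub>R w k)" using \<open>x \<in> _\<close> by (rule span_range_eq_finite_sums)
    have "(g ^^ p) x = (\<Sum>k<n. c k *\<^sub>R w (k + p))"
      by (simp add: x linear_sum[OF gp] linear_scale[OF gp] gpw)
    then show "norm ((g ^^ p) x) \<le> L * norm x" "norm x \<le> L * norm ((g ^^ p) x)"
      using upper lower by (simp_all add: x)
  qed
  have H_span: "x - y \<in> span (range w)" if "x \<in> H" "y \<in> H" for x y
    using that convex_hull_subset_span[of "range w"] by (auto simp: H_def intro: span_diff)
  have gpH: "(g ^^ p) ` H \<subseteq> convex hull (w ` {p..})" for p
  proof -
    have "(g ^^ p) ` H = convex hull ((g ^^ p) ` range w)"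
      unfolding H_def by (rule convex_hull_linear_image[OF gp])
    also have "\<dots> \<subseteq> convex hull (w ` {p..})" by (rule hull_mono) (auto simp: gpw)
    finally show ?thesis .
  qed
  have tail_H: "convex hull (w ` {p..}) \<subseteq> H" for p unfolding H_def by (rule hull_mono) auto
  have gH: "g x \<in> H" if "x \<in> H" for x using gpH[of 1] tail_H[of 1] that by auto
  have "L-lipschitz_on H g"
  proof (rule lipschitz_onI[OF _ L])
    fix x y assume "x \<in> H" "y \<in> H"
    then show "dist (g x) (g y) \<le> L * dist x y"
      using gp_bounds(1)[OF H_span, of x y 1] by (simp add: dist_norm linear_diff[OF g(1)])
  qed
  from lipschitz_extend_closure[OF this] obtain f
    where f: "L-lipschitz_on K f" "\<And>x. x \<in> H \<Longrightarrow> f x = g x" unfolding K_def by blast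
  have cont: "continuous_on K f" using f(1) by (rule lipschitz_on_continuous_on)
  have fK: "f ` K \<subseteq> K"
    unfolding K_def
    by (rule image_closure_subset) (use cont f(2) gH closure_subset[of H] in \<open>auto simp: K_def\<close>)
  have fpK: "(f ^^ p) ` K \<subseteq> K" for p by (induction p) (use fK in auto)
  have contp: "continuous_on K (f ^^ p)" for p
  proof (induction p)
    case (Suc p)
    have "continuous_on ((f ^^ p) ` K) f" using cont fpK by (rule continuous_on_subset)
    from continuous_on_compose[OF Suc this] show ?case by (simp add: o_def)
  qed (simp add: id_def)
  have fpH: "(f ^^ p) x = (g ^^ p) x" if "x \<in> H" for p x
  proof (induction p)
    case (Suc p)
    have "(g ^^ p) x \<in> H" using gpH[of p] tail_H[of p] that by blast
    with Suc show ?case by (simp add: f(2))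
  qed simp
  \<comment> \<open>Iterates push everything into the tails, which excludes fixed points.\<close>
  have fp_tail: "(f ^^ p) ` K \<subseteq> closure (convex hull (w ` {p..}))" for p
    unfolding K_def
  proof (rule image_closure_subset)
    show "(f ^^ p) ` H \<subseteq> closure (convex hull (w ` {p..}))"
      using gpH[of p] closure_subset[of "convex hull (w ` {p..})"] fpH by fastforce
  qed (use contp in \<open>auto simp: K_def\<close>)
  have fp_lim: "(\<lambda>n. (f ^^ p) (xs n)) \<longlonglongrightarrow> (f ^^ p) x"
    if "x \<in> K" "\<And>n. xs n \<in> H" "xs \<longlonglongrightarrow> x" for x p and xs :: "nat \<Rightarrow> 'a"
    by (rule continuous_on_tendsto_compose[OF contp that(3,1)]) (use that(2) HK in \<open>auto intro!: always_eventually\<close>)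
  have bounds: "dist ((f ^^ p) x) ((f ^^ p) y) \<le> L * dist x y" "dist x y \<le> L * dist ((f ^^ p) x) ((f ^^ p) y)"
    if xy: "x \<in> K" "y \<in> K" for x y p
  proof -
    from xy obtain xs ys where xs: "\<And>n. xs n \<in> H" "xs \<longlonglongrightarrow> x" and ys: "\<And>n. ys n \<in> H" "ys \<longlonglongrightarrow> y"
      unfolding K_def closure_sequential by blast
    note lims = tendsto_dist[OF fp_lim[OF xy(1) xs] fp_lim[OF xy(2) ys]] tendsto_dist[OF xs(2) ys(2)]
    have "dist ((f ^^ p) (xs n)) ((f ^^ p) (ys n)) \<le> L * dist (xs n) (ys n)"
      and "dist (xs n) (ys n) \<le> L * dist ((f ^^ p) (xs n)) ((f ^^ p) (ys n))" for n p
      using gp_bounds[OF H_span[OF xs(1)[of n] ys(1)[of n]], of p]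
      by (simp_all add: fpH xs ys dist_norm linear_diff[OF gp])
    note b = this
    show "dist ((f ^^ p) x) ((f ^^ p) y) \<le> L * dist x y"
      by (rule LIMSEQ_le[OF lims(1) tendsto_mult_left[OF lims(2)]]) (use b(1) in auto)
    show "dist x y \<le> L * dist ((f ^^ p) x) ((f ^^ p) y)"
      by (rule LIMSEQ_le[OF lims(2) tendsto_mult_left[OF lims(1)]]) (use b(2) in auto)
  qed
  have inj_f: "inj_on f K"
  proof (rule inj_onI)
    fix x y assume "x \<in> K" "y \<in> K" "f x = f y"
    then show "x = y" using bounds(2)[of x y 1] by simp
  qed
  have inv_fp: "(inv_into K f ^^ p) ((f ^^ p) x) = x" if "x \<in> K" for x p
  proof (induction p)
    case (Suc p)
    have "inv_into K f ((f ^^ Suc p) x) = (f ^^ p) x"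
      using inj_f fpK[of p] that by (simp add: image_subset_iff)
    with Suc show ?case by (simp add: funpow_Suc_right del: funpow.simps)
  qed simp
  have "uniformly_bilipschitz_on K f"
    unfolding uniformly_bilipschitz_on_def uniformly_lipschitz_on_def
  proof (intro conjI exI[of _ L] allI inj_f)
    show "L-lipschitz_on K (f ^^ p)" for p using bounds(1) by (intro lipschitz_onI L)
    show "L-lipschitz_on ((f ^^ p) ` K) (inv_into K f ^^ p)" for p
    proof (rule lipschitz_onI[OF _ L])
      fix a b assume "a \<in> (f ^^ p) ` K" "b \<in> (f ^^ p) ` K"
      then obtain x y where "a = (f ^^ p) x" "b = (f ^^ p) y" "x \<in> K" "y \<in> K" by blast
      then show "dist ((inv_into K f ^^ p) a) ((inv_into K f ^^ p) b) \<le> L * dist a b"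
        using bounds(2) by (simp add: inv_fp)
    qed
  qed
  moreover have "convex K" unfolding K_def H_def by (intro convex_closure convex_convex_hull)
  have "affine_map_on K f"
    unfolding affine_map_on_def
  proof (intro ballI)
    fix x y and t :: real assume xy: "x \<in> K" "y \<in> K" and t: "t \<in> {0..1}"
    from xy obtain xs ys where xs: "\<And>n. xs n \<in> H" "xs \<longlonglongrightarrow> x" and ys: "\<And>n. ys n \<in> H" "ys \<longlonglongrightarrow> y"
      unfolding K_def closure_sequential by blast
    have comb: "t *\<^sub>R x + (1 - t) *\<^sub>R y \<in> K" using \<open>convex K\<close> xy t by (auto intro: convexD)
    have combs: "t *\<^sub>R xs n + (1 - t) *\<^sub>R ys n \<in> H" for n
      using convex_convex_hull[of "range w"] xs ys t unfolding H_def by (auto intro: convexD)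
    have "(\<lambda>n. t *\<^sub>R xs n + (1 - t) *\<^sub>R ys n) \<longlonglongrightarrow> t *\<^sub>R x + (1 - t) *\<^sub>R y"
      by (intro tendsto_intros xs ys)
    from fp_lim[where p = 1, OF comb combs this]
    have "(\<lambda>n. f (t *\<^sub>R xs n + (1 - t) *\<^sub>R ys n)) \<longlonglongrightarrow> f (t *\<^sub>R x + (1 - t) *\<^sub>R y)" by simp
    moreover have "f (t *\<^sub>R xs n + (1 - t) *\<^sub>R ys n) = t *\<^sub>R f (xs n) + (1 - t) *\<^sub>R f (ys n)" for n
      using combs xs ys by (simp add: f(2) linear_add[OF g(1)] linear_scale[OF g(1)])
    moreover have "(\<lambda>n. t *\<^sub>R f (xs n) + (1 - t) *\<^sub>R f (ys n)) \<longlonglongrightarrow> t *\<^sub>R f x + (1 - t) *\<^sub>R f y"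
      using fp_lim[where p = 1, OF xy(1) xs] fp_lim[where p = 1, OF xy(2) ys] by (intro tendsto_intros) auto
    ultimately show "f (t *\<^sub>R x + (1 - t) *\<^sub>R y) = t *\<^sub>R f x + (1 - t) *\<^sub>R f y"
      using LIMSEQ_unique by fastforce
  qed
  ultimately have "f \<in> affine_uniformly_bilipschitz_maps K"
    using fK by (simp add: affine_uniformly_bilipschitz_maps_def)
  moreover have "K \<in> bounded_closed_convex_subsets C"
  proof -
    have "H \<subseteq> C" unfolding H_def using C by (intro hull_minimal)
    then have "K \<subseteq> C" unfolding K_def using C by (intro closure_minimal)
    moreover have "w 0 \<in> K" using HK by (auto simp: H_def hull_inc)
    ultimately show ?thesis
      using \<open>convex K\<close> bounded_subset[OF C(2)] by (auto simp: bounded_closed_convex_subsets_def K_def)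
  qed
  moreover have "f x \<noteq> x" if "x \<in> K" for x
  proof
    assume "f x = x"
    then have "(f ^^ p) x = x" for p by (induction p) auto
    then have "x \<in> closure (convex hull (w ` {p..}))" for p
      using fp_tail[of p] that by force
    with tails show False by blast
  qed
  ultimately show ?thesis unfolding has_G_FPP_def using fK by blast
qed

lemma sum_tail_of_shifted_coefficients:
  fixes c :: "nat \<Rightarrow> 'b::comm_monoid_add"
  shows "(\<Sum>j\<in>{l..<n + p}. if j < p then 0 else c (j - p)) = (\<Sum>i\<in>{l - p..<n}. c i)"
proof (induction n)
  case 0
  show ?case by (auto intro!: sum.neutral)
next
  case (Suc n)
  show ?case
  proof (cases "l \<le> n + p")
    case True
    then have "l - p \<le> n" by simp
    with True Suc show ?thesis by simp
  qed simp
qed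

lemma sum_shifted_coefficients:
  fixes v :: "nat \<Rightarrow> 'a::real_vector" and c :: "nat \<Rightarrow> real"
  shows "(\<Sum>j<n + p. (if j < p then 0 else c (j - p)) *\<^sub>R v j) = (\<Sum>i<n. c i *\<^sub>R v (i + p))"
  by (induction n) (auto intro!: sum.neutral)

text \<open>The sum of the absolute values of the coefficients does not change under a shift.\<close>

lemma l1_basis_imp_not_FPP:
  fixes w :: "nat \<Rightarrow> 'a::banach"
  assumes \<delta>: "\<delta> > 0" and lower: "\<And>n c. \<delta> * (\<Sum>k<n. \<bar>c k\<bar>) \<le> norm (\<Sum>k<n. c k *\<^sub>R w k)"
    and tails: "(\<Inter>p. closure (convex hull (w ` {p..}))) = {}"
    and C: "range w \<subseteq> C" "bounded C" "closed C" "convex C"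
  shows "\<not> has_G_FPP C affine_uniformly_bilipschitz_maps"
proof -
  obtain M where M: "\<And>k. norm (w k) \<le> M" "M \<ge> 0"
    using C(1) bounded_pos[THEN iffD1, OF C(2)] by (fastforce simp: image_subset_iff)
  have upper: "norm (\<Sum>k<n. c k *\<^sub>R w (k + p)) \<le> M * (\<Sum>k<n. \<bar>c k\<bar>)" for n p and c :: "nat \<Rightarrow> real"
  proof -
    have "norm (\<Sum>k<n. c k *\<^sub>R w (k + p)) \<le> (\<Sum>k<n. \<bar>c k\<bar> * M)"
      by (rule sum_norm_le) (simp add: M mult_left_mono)
    then show ?thesis by (simp add: sum_distrib_left mult.commute)
  qed
  have le: "(\<Sum>k<n. \<bar>c k\<bar>) \<le> norm (\<Sum>k<n. c k *\<^sub>R w (k + p)) / \<delta>" for n p and c :: "nat \<Rightarrow> real"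
  proof -
    have "(\<Sum>j<n + p. \<bar>if j < p then 0 else c (j - p)\<bar>) = (\<Sum>i<n. \<bar>c i\<bar>)"
      by (induction n) (auto intro!: sum.neutral)
    then show ?thesis
      using lower[where n = "n + p" and c = "\<lambda>j. if j < p then 0 else c (j - p)"] \<delta>
      by (simp add: sum_shifted_coefficients field_simps)
  qed
  show ?thesis
  proof (rule shift_equivalent_imp_not_FPP[of w "M / \<delta>", OF _ _ _ tails C])
    fix n c k assume zero: "(\<Sum>k<n. c k *\<^sub>R w k) = 0" and "k < n"
    have "(\<Sum>k<n. \<bar>c k\<bar>) \<le> 0" using le[where c = c and n = n and p = 0] zero by simp
    then show "c k = 0" using \<open>k < n\<close> by (simp add: sum_nonneg_eq_0_iff order_antisym_conv sum_nonneg)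
  next
    fix p n c
    show "norm (\<Sum>k<n. c k *\<^sub>R w (k + p)) \<le> M / \<delta> * norm (\<Sum>k<n. c k *\<^sub>R w k)"
      using order_trans[OF upper[where c = c and n = n and p = p] mult_left_mono[OF le[where c = c and n = n and p = 0] M(2)]] by simp
    show "norm (\<Sum>k<n. c k *\<^sub>R w k) \<le> M / \<delta> * norm (\<Sum>k<n. c k *\<^sub>R w (k + p))"
      using order_trans[OF upper[where c = c and n = n and p = 0] mult_left_mono[OF le[where c = c and n = n and p = p] M(2)]] by simp
  qed
qed

text \<open>Here the norm is equivalent to the maximum of the absolute values of the tail sums of the
coefficients. Moving the coefficients \<open>p\<close> places to the right repeats the full sum \<open>p\<close> times and
leaves the other tail sums unchanged. The coefficients themselves are differences of tail sums,
which gives independence.\<close>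

lemma summing_basis_imp_not_FPP:
  fixes v :: "nat \<Rightarrow> 'a::banach"
  assumes \<delta>: "\<delta> > 0"
    and lower: "\<And>n c l. l < n \<Longrightarrow> \<delta> * \<bar>\<Sum>i\<in>{l..<n}. c i\<bar> \<le> norm (\<Sum>i<n. c i *\<^sub>R v i)"
    and upper: "\<And>n c G. (\<And>l. l < n \<Longrightarrow> \<bar>\<Sum>i\<in>{l..<n}. c i\<bar> \<le> G) \<Longrightarrow> 0 \<le> G \<Longrightarrow>
      norm (\<Sum>i<n. c i *\<^sub>R v i) \<le> B * G"
    and tails: "(\<Inter>p. closure (convex hull (v ` {p..}))) = {}"
    and C: "range v \<subseteq> C" "bounded C" "closed C" "convex C"
  shows "\<not> has_G_FPP C affine_uniformly_bilipschitz_maps"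
proof (rule shift_equivalent_imp_not_FPP[of v "B / \<delta>", OF _ _ _ tails C])
  fix n c k assume zero: "(\<Sum>k<n. c k *\<^sub>R v k) = 0" and "k < n"
  have tail: "(\<Sum>i\<in>{l..<n}. c i) = 0" for l
    using lower[where l = l and n = n and c = c] \<delta> zero by (cases "l < n") (auto simp: mult_le_0_iff)
  show "c k = 0"
    using tail[of k] tail[of "Suc k"] \<open>k < n\<close> by (simp add: sum.atLeast_Suc_lessThan)
next
  fix p n and c :: "nat \<Rightarrow> real"
  define c' where "c' j = (if j < p then 0 else c (j - p))" for j
  have c'_sum: "(\<Sum>i<n. c i *\<^sub>R v (i + p)) = (\<Sum>j<n + p. c' j *\<^sub>R v j)"
    by (simp add: c'_def sum_shifted_coefficients)
  have c'_tail: "(\<Sum>j\<in>{l..<n + p}. c' j) = (\<Sum>i\<in>{l - p..<n}. c i)" for l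
    by (simp add: c'_def sum_tail_of_shifted_coefficients)
  define u where "u = (\<Sum>k<n. c k *\<^sub>R v k)"
  define u' where "u' = (\<Sum>k<n. c k *\<^sub>R v (k + p))"
  have "norm u' \<le> B * (norm u / \<delta>)"
    unfolding u'_def c'_sum
  proof (rule upper)
    fix l
    show "\<bar>\<Sum>j\<in>{l..<n + p}. c' j\<bar> \<le> norm u / \<delta>"
      using lower[where l = "l - p" and n = n and c = c] \<delta> by (cases "l - p < n") (auto simp: c'_tail u_def field_simps)
  qed (use \<delta> in auto)
  then show "norm (\<Sum>k<n. c k *\<^sub>R v (k + p)) \<le> B / \<delta> * norm (\<Sum>k<n. c k *\<^sub>R v k)"
    by (simp add: u_def u'_def)
  have "norm u \<le> B * (norm u' / \<delta>)"
    unfolding u_def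
  proof (rule upper)
    fix l assume "l < n"
    then show "\<bar>\<Sum>i\<in>{l..<n}. c i\<bar> \<le> norm u' / \<delta>"
      using lower[where l = "l + p" and n = "n + p" and c = c'] \<delta> by (auto simp: c'_tail c'_sum u'_def field_simps)
  qed (use \<delta> in auto)
  then show "norm (\<Sum>k<n. c k *\<^sub>R v k) \<le> B / \<delta> * norm (\<Sum>k<n. c k *\<^sub>R v (k + p))"
    by (simp add: u_def u'_def)
qed

section \<open>Rosenthal's theorem\<close>

definition oscillates_along :: "(nat \<Rightarrow> 's set) \<Rightarrow> (nat \<Rightarrow> 's set) \<Rightarrow> nat set \<Rightarrow> 's \<Rightarrow> bool" where
  "oscillates_along A B M s \<longleftrightarrow> infinite {m\<in>M. s \<in> A m} \<and> infinite {m\<in>M. s \<in> B m}"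

text \<open>In the application \<open>s\<close> is a functional, and the pairs \<open>A m\<close>, \<open>B m\<close> say that its value at the \<open>m\<close>-th
point is above \<open>q\<close> or below \<open>p\<close>. The set \<open>D\<close> collects the functionals with one of these two properties
prescribed at finitely many points; hereditary oscillation is the induction hypothesis that allows
prescribing it at one more.\<close>

definition hereditarily_oscillating ::
    "(nat \<Rightarrow> 's set) \<Rightarrow> (nat \<Rightarrow> 's set) \<Rightarrow> 's set \<Rightarrow> nat set \<Rightarrow> bool" where
  "hereditarily_oscillating A B D L \<longleftrightarrow>
     (\<forall>M\<subseteq>L. infinite M \<longrightarrow> (\<exists>s\<in>D. oscillates_along A B M s))"

lemma oscillates_along_almost_subset:
  assumes "oscillates_along A B M s" "M \<subseteq> F \<union> N" "finite F"
  shows "oscillates_along A B N s"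
proof -
  have "{m\<in>M. s \<in> X m} \<subseteq> F \<union> {m\<in>N. s \<in> X m}" for X using assms(2) by auto
  then have "infinite {m\<in>N. s \<in> X m}" if "infinite {m\<in>M. s \<in> X m}" for X
    using that assms(3) by (meson finite_UnI finite_subset)
  with assms(1) show ?thesis by (auto simp: oscillates_along_def)
qed

text \<open>The key step of Rosenthal's argument. If it failed, then there would be \<open>n 0 \<in> L\<close>, \<open>n 1 \<in> M 0\<close>,
\<open>n 2 \<in> M 1\<close>, \<open>\<dots>\<close> with decreasing infinite sets \<open>M j\<close>, such that for some \<open>D j \<in> \<D>\<close> and one of the two
sets \<open>X\<close> at \<open>n j\<close>, no point of \<open>D j \<inter> X\<close> oscillates along \<open>M j\<close>. As \<open>\<D>\<close> is finite, the same choice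
occurs for infinitely many \<open>j\<close>. A point of \<open>D j\<close> that oscillates along these \<open>n j\<close> lies in one of the
corresponding sets \<open>X\<close>, which is a contradiction, since \<open>M j\<close> contains all later \<open>n i\<close>.\<close>

lemma hereditarily_oscillating_split:
  assumes fin: "finite \<D>" and L: "infinite L" and osc: "\<And>D. D \<in> \<D> \<Longrightarrow> hereditarily_oscillating A B D L"
  obtains n L' where "n \<in> L" "L' \<subseteq> L" "infinite L'" "\<And>m. m \<in> L' \<Longrightarrow> n < m"
    and "\<And>D. D \<in> \<D> \<Longrightarrow> hereditarily_oscillating A B (D \<inter> A n) L'"
    and "\<And>D. D \<in> \<D> \<Longrightarrow> hereditarily_oscillating A B (D \<inter> B n) L'"
proof (rule ccontr)
  note conclude = that
  assume none: "\<not> thesis"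
  define X where "X b n = (if b then A n else B n)" for b n
  define bad where "bad r \<longleftrightarrow> (case r of (n, M, D, b) \<Rightarrow>
      n \<in> L \<and> M \<subseteq> L \<and> infinite M \<and> (\<forall>m\<in>M. n < m) \<and> D \<in> \<D> \<and>
      (\<forall>s\<in>D \<inter> X b n. \<not> oscillates_along A B M s))" for r
  have ex_bad: "\<exists>n M D b. n \<in> L0 \<and> M \<subseteq> L0 \<and> bad (n, M, D, b)" if L0: "infinite L0" "L0 \<subseteq> L" for L0
  proof -
    from L0 obtain n where n: "n \<in> L0" by (metis finite.emptyI equals0I)
    define L' where "L' = {m\<in>L0. n < m}"
    have "L0 \<subseteq> {..n} \<union> L'" by (auto simp: L'_def)
    with L0(1) have L': "infinite L'" by (meson finite_UnI finite_atMost finite_subset)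
    have "\<not> (\<forall>D\<in>\<D>. hereditarily_oscillating A B (D \<inter> A n) L' \<and> hereditarily_oscillating A B (D \<inter> B n) L')"
    proof
      assume all: "\<forall>D\<in>\<D>. hereditarily_oscillating A B (D \<inter> A n) L' \<and>
        hereditarily_oscillating A B (D \<inter> B n) L'"
      have "thesis" by (rule conclude[of n L']) (use n L0 L' all in \<open>auto simp: L'_def\<close>)
      with none show False ..
    qed
    then obtain D b where "D \<in> \<D>" "\<not> hereditarily_oscillating A B (D \<inter> X b n) L'"
      unfolding X_def by (metis (full_types))
    then obtain M where "M \<subseteq> L'" "infinite M" "\<forall>s\<in>D \<inter> X b n. \<not> oscillates_along A B M s"
      unfolding hereditarily_oscillating_def by blast
    with n L0 \<open>D \<in> \<D>\<close> show ?thesis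
      unfolding bad_def by (intro exI[of _ n] exI[of _ M] exI[of _ D] exI[of _ b]) (auto simp: L'_def)
  qed
  have "\<exists>f. \<forall>j. bad (f j) \<and> fst (f (Suc j)) \<in> fst (snd (f j)) \<and> fst (snd (f (Suc j))) \<subseteq> fst (snd (f j))"
  proof (rule dependent_nat_choice)
    show "\<exists>r. bad r" using ex_bad[OF L] by blast
    fix r :: "nat \<times> nat set \<times> 'a set \<times> bool" assume "bad r"
    then have "infinite (fst (snd r))" "fst (snd r) \<subseteq> L" by (auto simp: bad_def split: prod.splits)
    from ex_bad[OF this]
    show "\<exists>r'. bad r' \<and> fst r' \<in> fst (snd r) \<and> fst (snd r') \<subseteq> fst (snd r)" by force
  qed
  then obtain f where f: "\<And>j. bad (f j)" "\<And>j. fst (f (Suc j)) \<in> fst (snd (f j))"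
    "\<And>j. fst (snd (f (Suc j))) \<subseteq> fst (snd (f j))" by blast
  define n where "n j = fst (f j)" for j
  define M where "M j = fst (snd (f j))" for j
  define D where "D j = fst (snd (snd (f j)))" for j
  define b where "b j = snd (snd (snd (f j)))" for j
  have bad: "n j \<in> L" "\<And>m. m \<in> M j \<Longrightarrow> n j < m" "D j \<in> \<D>"
    "\<And>s. s \<in> D j \<Longrightarrow> s \<in> X (b j) (n j) \<Longrightarrow> \<not> oscillates_along A B (M j) s" for j
    using f(1)[of j] by (auto simp: bad_def n_def M_def D_def b_def split: prod.splits)
  have M_dec: "M k \<subseteq> M j" if "j \<le> k" for j k
    using that f(3) unfolding M_def by (rule lift_Suc_antimono_le[rotated])
  have later: "n k \<in> M j" if "j < k" for j k
  proof -
    obtain i where i: "k = Suc i" "j \<le> i" using \<open>j < k\<close> by (cases k) auto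
    then show ?thesis using f(2)[of i] M_dec[of j i] by (auto simp: n_def M_def)
  qed
  then have n_mono: "strict_mono n" using bad(2) by (intro strict_monoI) blast
  have "finite ((\<lambda>j. (D j, b j)) ` UNIV)"
    by (rule finite_subset[of _ "\<D> \<times> UNIV"]) (use bad(3) fin in auto)
  from pigeonhole_infinite[OF _ this] obtain i where
    inf: "infinite {j\<in>UNIV. (D j, b j) = (D i, b i)}" by auto
  define J where "J = {j. D j = D i \<and> b j = b i}"
  have "infinite (n ` J)"
    using inf strict_mono_imp_inj_on[OF n_mono] by (auto simp: J_def finite_image_iff inj_on_subset)
  moreover have "n ` J \<subseteq> L" using bad(1) by auto
  ultimately obtain s where s: "s \<in> D i" "oscillates_along A B (n ` J) s"
    using osc[OF bad(3)[of i]] unfolding hereditarily_oscillating_def by blast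
  then have "infinite {m \<in> n ` J. s \<in> X (b i) m}" by (cases "b i") (simp_all add: oscillates_along_def X_def)
  then obtain m where "m \<in> n ` J" "s \<in> X (b i) m" by (metis (mono_tags, lifting) empty_Collect_eq finite.emptyI)
  then obtain j where j: "D j = D i" "b j = b i" "s \<in> X (b i) (n j)" by (auto simp: J_def)
  have "n k \<in> n ` {..j} \<union> M j" for k using later[of j k] by (cases "k \<le> j") auto
  then have "n ` J \<subseteq> n ` {..j} \<union> M j" by blast
  with s(2) have "oscillates_along A B (M j) s" by (rule oscillates_along_almost_subset) auto
  moreover have "s \<in> D j" "s \<in> X (b j) (n j)" using s(1) j by simp_all
  ultimately show False using bad(4) by blast
qed

text \<open>Iterating the previous lemma on the family \<open>\<D> j\<close> of all \<open>2 ^ j\<close> intersections built so far keeps every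
one of them hereditarily oscillating, in particular nonempty.\<close>

lemma hereditarily_oscillating_imp_independent:
  assumes L: "infinite L" and osc: "hereditarily_oscillating A B S L"
  obtains r :: "nat \<Rightarrow> nat" where "strict_mono r" "range r \<subseteq> L"
    and "\<forall>\<epsilon> N. \<exists>s\<in>S. \<forall>k<N. s \<in> (if \<epsilon> k then A (r k) else B (r k))"
proof -
  define P where "P r \<longleftrightarrow> (case r of (n :: nat, M, \<D>) \<Rightarrow> finite \<D> \<and> infinite M \<and> M \<subseteq> L \<and>
      (\<forall>D\<in>\<D>. hereditarily_oscillating A B D M))" for r
  define Q where "Q r r' \<longleftrightarrow> (case (r, r') of ((n :: nat, M, \<D>), (n' :: nat, M', \<D>')) \<Rightarrow>
      n' \<in> M \<and> M' \<subseteq> M \<and> (\<forall>m\<in>M'. n' < m) \<and> \<D>' = (\<lambda>D. D \<inter> A n') ` \<D> \<union> (\<lambda>D. D \<inter> B n') ` \<D>)"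
    for r r'
  have "\<exists>f. \<forall>j. (P (f j) \<and> (j = 0 \<longrightarrow> f j = (0, L, {S}))) \<and> Q (f j) (f (Suc j))"
  proof (rule dependent_nat_choice)
    show "\<exists>r. P r \<and> (0 = (0::nat) \<longrightarrow> r = (0, L, {S}))" using L osc by (simp add: P_def)
    fix r and j :: nat assume r: "P r \<and> (j = 0 \<longrightarrow> r = (0, L, {S}))"
    obtain n M \<D> where [simp]: "r = (n, M, \<D>)" by (cases r)
    from r have fin: "finite \<D>" and M: "infinite M" and sub: "M \<subseteq> L"
      and D: "\<And>D. D \<in> \<D> \<Longrightarrow> hereditarily_oscillating A B D M" by (auto simp: P_def)
    obtain n' M' where n': "n' \<in> M" "M' \<subseteq> M" "infinite M'" "\<And>m. m \<in> M' \<Longrightarrow> n' < m"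
      "\<And>D. D \<in> \<D> \<Longrightarrow> hereditarily_oscillating A B (D \<inter> A n') M'"
      "\<And>D. D \<in> \<D> \<Longrightarrow> hereditarily_oscillating A B (D \<inter> B n') M'"
      using hereditarily_oscillating_split[OF fin M D] by blast
    with fin sub show "\<exists>r'. (P r' \<and> (Suc j = 0 \<longrightarrow> r' = (0, L, {S}))) \<and> Q r r'"
      by (intro exI[of _ "(n', M', (\<lambda>D. D \<inter> A n') ` \<D> \<union> (\<lambda>D. D \<inter> B n') ` \<D>)"])
        (auto simp: P_def Q_def)
  qed
  then obtain f where f: "\<And>j. P (f j)" "f 0 = (0, L, {S})" "\<And>j. Q (f j) (f (Suc j))" by blast
  define n where "n j = fst (f j)" for j
  define M where "M j = fst (snd (f j))" for j
  define \<D> where "\<D> j = snd (snd (f j))" for j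
  have P: "infinite (M j)" "M j \<subseteq> L" "\<And>D. D \<in> \<D> j \<Longrightarrow> hereditarily_oscillating A B D (M j)" for j
    using f(1)[of j] by (auto simp: P_def M_def \<D>_def split: prod.splits)
  have Q: "n (Suc j) \<in> M j" "\<And>m. m \<in> M (Suc j) \<Longrightarrow> n (Suc j) < m"
    "\<D> (Suc j) = (\<lambda>D. D \<inter> A (n (Suc j))) ` \<D> j \<union> (\<lambda>D. D \<inter> B (n (Suc j))) ` \<D> j" for j
    using f(3)[of j] by (auto simp: Q_def n_def M_def \<D>_def split: prod.splits)
  define r where "r k = n (Suc k)" for k
  show thesis
  proof (rule that[of r])
    show "strict_mono r" unfolding strict_mono_Suc_iff r_def using Q(1,2) by blast
    show "range r \<subseteq> L" using Q(1) P(2) by (auto simp: r_def)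
    show "\<forall>\<epsilon> N. \<exists>s\<in>S. \<forall>k<N. s \<in> (if \<epsilon> k then A (r k) else B (r k))"
    proof (intro allI)
      fix \<epsilon> :: "nat \<Rightarrow> bool" and N
      define E where "E N = {s\<in>S. \<forall>k<N. s \<in> (if \<epsilon> k then A (r k) else B (r k))}" for N
      have "E N \<in> \<D> N" for N
      proof (induction N)
        case 0
        then show ?case using f(2) by (simp add: E_def \<D>_def)
      next
        case (Suc N)
        have "E (Suc N) = E N \<inter> (if \<epsilon> N then A (r N) else B (r N))"
          by (auto simp: E_def less_Suc_eq)
        with Suc show ?case by (auto simp: Q(3) r_def)
      qed
      then have "\<exists>s\<in>E N. oscillates_along A B (M N) s"
        using P unfolding hereditarily_oscillating_def by blast
      then show "\<exists>s\<in>S. \<forall>k<N. s \<in> (if \<epsilon> k then A (r k) else B (r k))" by (force simp only: E_def)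
    qed
  qed
qed

text \<open>The limit is the supremum of all \<open>p\<close> that are eventually lower bounds.\<close>

lemma no_rational_oscillation_imp_convergent:
  fixes a :: "nat \<Rightarrow> real"
  assumes M: "\<And>k. \<bar>a k\<bar> \<le> M"
    and osc: "\<And>p q :: rat. p < q \<Longrightarrow> finite {k. a k < of_rat p} \<or> finite {k. a k > of_rat q}"
  shows "convergent a"
proof -
  define S where "S = {p. finite {k. a k < p}}"
  define l where "l = Sup S"
  have low: "- M \<in> S"
  proof -
    have "{k. a k < - M} = {}" using M by (auto simp: abs_le_iff not_less minus_le_iff)
    then show ?thesis by (simp add: S_def)
  qed
  have bdd: "bdd_above S"
  proof (rule bdd_aboveI[of _ "M + 1"], rule ccontr)
    fix p assume p: "p \<in> S" "\<not> p \<le> M + 1"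
    have "a k < p" for k using M[of k] p(2) by linarith
    then show False using p(1) by (simp add: S_def)
  qed
  have "a \<longlonglongrightarrow> l"
  proof (rule order_tendstoI)
    fix c assume "c < l"
    then obtain p where p: "p \<in> S" "c < p" using less_cSupE[of c S] low unfolding l_def by blast
    then have "eventually (\<lambda>k. \<not> a k < p) sequentially"
      using eventually_cofinite[of "\<lambda>k. \<not> a k < p"] by (simp add: S_def cofinite_eq_sequentially)
    then show "eventually (\<lambda>k. c < a k) sequentially" by eventually_elim (use p in auto)
  next
    fix c assume "l < c"
    obtain q where q: "l < of_rat q" "of_rat q < c" using of_rat_dense[OF \<open>l < c\<close>] by blast
    obtain p where p: "l < of_rat p" "of_rat p < (of_rat q :: real)" using of_rat_dense[OF q(1)] by blast
    have "of_rat p \<notin> S" using cSup_upper[OF _ bdd, of "of_rat p"] p(1) by (auto simp: l_def)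
    then have "finite {k. a k > of_rat q}" using osc[of p q] p(2) by (auto simp: S_def of_rat_less)
    then have "eventually (\<lambda>k. \<not> a k > of_rat q) sequentially"
      using eventually_cofinite[of "\<lambda>k. \<not> a k > of_rat q"] by (simp add: cofinite_eq_sequentially)
    then show "eventually (\<lambda>k. a k < c) sequentially" by eventually_elim (use q in auto)
  qed
  then show ?thesis by (auto simp: convergent_def)
qed

text \<open>If no pair \<open>p < q\<close> and no set of indices were hereditarily oscillating, then each of the countably many
rational pairs could be treated in turn by passing to a subsequence along which no functional of the
unit ball oscillates across it. The diagonal subsequence would then be weakly Cauchy.\<close>

lemma weakly_Cauchy_subsequence_or_oscillating:
  fixes x :: "nat \<Rightarrow> 'a::real_normed_vector"
  assumes M: "\<And>n. norm (x n) \<le> M"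
    and no_subseq: "\<And>r. strict_mono r \<Longrightarrow> \<not> weakly_Cauchy (x \<circ> r)"
  obtains p q :: real and L where "p < q" "infinite L"
    "hereditarily_oscillating (\<lambda>n. {\<phi> :: 'a \<Rightarrow>\<^sub>L real. q < blinfun_apply \<phi> (x n)}) (\<lambda>n. {\<phi>. blinfun_apply \<phi> (x n) < p}) (cball 0 1) L"
proof (rule ccontr)
  note conclude = that
  assume none: "\<not> thesis"
  define osc where "osc p q N \<longleftrightarrow>
    (\<exists>\<phi>\<in>cball 0 1. oscillates_along (\<lambda>n. {\<phi> :: 'a \<Rightarrow>\<^sub>L real. q < blinfun_apply \<phi> (x n)})
      (\<lambda>n. {\<phi>. blinfun_apply \<phi> (x n) < p}) N \<phi>)"
    for p q N
  have ex: "\<exists>N\<subseteq>L. infinite N \<and> \<not> osc p q N" if "p < q" "infinite L" for p q :: real and L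
  proof -
    have "\<not> hereditarily_oscillating (\<lambda>n. {\<phi> :: 'a \<Rightarrow>\<^sub>L real. q < blinfun_apply \<phi> (x n)})
        (\<lambda>n. {\<phi>. blinfun_apply \<phi> (x n) < p}) (cball 0 1) L"
      using none conclude[OF that] by blast
    then show ?thesis unfolding hereditarily_oscillating_def osc_def by blast
  qed
  have osc_mono: "osc p q N'" if "osc p q N" "N \<subseteq> N'" for p q N N'
  proof -
    have "N \<subseteq> {} \<union> N'" using that(2) by simp
    with that(1) oscillates_along_almost_subset[OF _ this] show ?thesis
      unfolding osc_def by (meson finite.emptyI)
  qed
  define P where "P n s \<longleftrightarrow> (case from_nat n of (p, q) \<Rightarrow>
    (p :: rat) < q \<longrightarrow> \<not> osc (of_rat p) (of_rat q) (range s))" for n and s :: "nat \<Rightarrow> nat"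
  interpret subseqs P
  proof
    fix n and s :: "nat \<Rightarrow> nat" assume s: "strict_mono s"
    obtain p q :: rat where pq: "from_nat n = (p, q)" by (cases "from_nat n :: rat \<times> rat")
    show "\<exists>r'. strict_mono r' \<and> P n (s \<circ> r')"
    proof (cases "p < q")
      case False
      then show ?thesis using pq strict_mono_id by (auto simp: P_def)
    next
      case True
      have "infinite (range s)" using s by (simp add: range_inj_infinite strict_mono_imp_inj_on)
      with True ex[of "of_rat p" "of_rat q"] obtain N
        where N: "N \<subseteq> range s" "infinite N" "\<not> osc (of_rat p) (of_rat q) N"
        by (auto simp: of_rat_less)
      define J where "J = {k. s k \<in> N}"
      have "N \<subseteq> s ` J" using N(1) by (auto simp: J_def)
      then have J: "infinite J" using N(2) finite_surj by blast
      have "range (s \<circ> enumerate J) \<subseteq> N"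
        using enumerate_in_set[OF J] by (auto simp: J_def)
      with N(3) osc_mono have "\<not> osc (of_rat p) (of_rat q) (range (s \<circ> enumerate J))" by blast
      then show ?thesis using strict_mono_enumerate[OF J] pq by (auto simp: P_def)
    qed
  qed
  have stable: "P n (s \<circ> r)" if "strict_mono r" "P n s" for r s n
  proof -
    have "range (s \<circ> r) \<subseteq> range s" by auto
    then show ?thesis using that(2) osc_mono unfolding P_def by (auto split: prod.splits)
  qed
  have diag: "P k (diagseq \<circ> ((+) (Suc k)))" for k by (rule diagseq_holds) (rule stable)
  have conv: "convergent (\<lambda>k. blinfun_apply \<phi> (x (diagseq k)))" if \<phi>: "norm \<phi> \<le> 1" for \<phi> :: "'a \<Rightarrow>\<^sub>L real"
  proof (rule no_rational_oscillation_imp_convergent)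
    show "\<bar>\<phi> (x (diagseq k))\<bar> \<le> M" for k
    proof -
      have "\<bar>\<phi> (x (diagseq k))\<bar> \<le> norm \<phi> * norm (x (diagseq k))" using norm_blinfun[of \<phi>] by simp
      also have "\<dots> \<le> 1 * norm (x (diagseq k))" using \<phi> by (intro mult_right_mono) auto
      finally show ?thesis using M[of "diagseq k"] by simp
    qed
    fix p q :: rat assume "p < q"
    define j where "j = Suc (to_nat (p, q))"
    have not_osc: "\<not> osc (of_rat p) (of_rat q) (range (diagseq \<circ> ((+) j)))"
      using diag[of "to_nat (p, q)"] \<open>p < q\<close> by (simp add: P_def j_def)
    show "finite {k. \<phi> (x (diagseq k)) < of_rat p} \<or> finite {k. \<phi> (x (diagseq k)) > of_rat q}"
    proof (rule ccontr)
      assume inf: "\<not> ?thesis"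
      have "infinite {m \<in> range (diagseq \<circ> ((+) j)). R (x m)}" if "infinite {k. R (x (diagseq k))}" for R
      proof -
        have "{k. R (x (diagseq k))} \<subseteq> {..<j} \<union> {k. j \<le> k \<and> R (x (diagseq k))}" by auto
        then have "infinite {k. j \<le> k \<and> R (x (diagseq k))}"
          using that by (meson finite_UnI finite_lessThan finite_subset)
        then have "infinite (diagseq ` {k. j \<le> k \<and> R (x (diagseq k))})"
          using strict_mono_imp_inj_on[OF subseq_diagseq] by (simp add: finite_image_iff inj_on_subset)
        moreover have "diagseq ` {k. j \<le> k \<and> R (x (diagseq k))} \<subseteq> {m \<in> range (diagseq \<circ> ((+) j)). R (x m)}"
          by (auto simp: le_iff_add)
        ultimately show ?thesis by (rule infinite_super[rotated])
      qed
      from this[of "\<lambda>v. \<phi> v < of_rat p"] this[of "\<lambda>v. \<phi> v > of_rat q"] inf \<phi>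
      have "osc (of_rat p) (of_rat q) (range (diagseq \<circ> ((+) j)))"
        unfolding osc_def oscillates_along_def by (intro bexI[of _ \<phi>]) auto
      with not_osc show False ..
    qed
  qed
  have "weakly_Cauchy (x \<circ> diagseq)"
    unfolding weakly_Cauchy_def
  proof
    fix \<phi> :: "'a \<Rightarrow>\<^sub>L real"
    have "convergent (\<lambda>k. (\<phi> /\<^sub>R norm \<phi>) (x (diagseq k)))"
      by (rule conv) (cases "\<phi> = 0"; simp)
    then have "convergent (\<lambda>k. norm \<phi> * (\<phi> /\<^sub>R norm \<phi>) (x (diagseq k)))"
      by (intro convergent_mult convergent_const)
    moreover have "norm \<phi> * (\<phi> /\<^sub>R norm \<phi>) v = \<phi> v" for v
      by (cases "\<phi> = 0") (auto simp: blinfun.scaleR_left)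
    ultimately show "Cauchy (\<lambda>n. \<phi> ((x \<circ> diagseq) n))" by (simp add: convergent_Cauchy)
  qed
  with no_subseq[OF subseq_diagseq] show False ..
qed

text \<open>Two functionals of norm at most one are chosen, one above \<open>q\<close> where \<open>c k \<ge> 0\<close> and below \<open>p\<close> elsewhere,
the other one with the opposite behaviour. Their difference gains \<open>q - p\<close> on every term.\<close>

lemma independent_imp_l1_lower_bound:
  fixes x :: "nat \<Rightarrow> 'a::real_normed_vector"
  assumes ind: "\<forall>\<epsilon> N. \<exists>\<phi>\<in>cball 0 1. \<forall>k<N. \<phi> \<in>
      (if \<epsilon> k then {\<phi> :: 'a \<Rightarrow>\<^sub>L real. q < blinfun_apply \<phi> (x k)} else {\<phi>. blinfun_apply \<phi> (x k) < p})"
  shows "(q - p) / 2 * (\<Sum>k<n. \<bar>c k\<bar>) \<le> norm (\<Sum>k<n. c k *\<^sub>R x k)"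
proof -
  from ind[rule_format, of n "\<lambda>k. c k \<ge> 0"] obtain \<phi> :: "'a \<Rightarrow>\<^sub>L real" where \<phi>: "norm \<phi> \<le> 1"
    "\<forall>k<n. \<phi> \<in> (if c k \<ge> 0 then {\<phi>. q < blinfun_apply \<phi> (x k)} else {\<phi>. blinfun_apply \<phi> (x k) < p})"
    by (auto simp only: mem_cball_0)
  from ind[rule_format, of n "\<lambda>k. c k < 0"] obtain \<psi> :: "'a \<Rightarrow>\<^sub>L real" where \<psi>: "norm \<psi> \<le> 1"
    "\<forall>k<n. \<psi> \<in> (if c k < 0 then {\<phi>. q < blinfun_apply \<phi> (x k)} else {\<phi>. blinfun_apply \<phi> (x k) < p})"
    by (auto simp only: mem_cball_0)
  let ?v = "\<Sum>k<n. c k *\<^sub>R x k"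
  have "(q - p) * (\<Sum>k<n. \<bar>c k\<bar>) = (\<Sum>k<n. (q - p) * \<bar>c k\<bar>)" by (rule sum_distrib_left)
  also have "\<dots> \<le> (\<Sum>k<n. c k * ((\<phi> - \<psi>) (x k)))"
  proof (rule sum_mono)
    fix k assume "k \<in> {..<n}"
    then have "c k \<ge> 0 \<Longrightarrow> q - p \<le> \<phi> (x k) - \<psi> (x k)" "c k < 0 \<Longrightarrow> \<phi> (x k) - \<psi> (x k) \<le> p - q"
      using \<phi>(2)[rule_format, of k] \<psi>(2)[rule_format, of k] by auto
    then show "(q - p) * \<bar>c k\<bar> \<le> c k * ((\<phi> - \<psi>) (x k))"
      using mult_left_mono[of "q - p" "\<phi> (x k) - \<psi> (x k)" "c k"]
        mult_left_mono_neg[of "\<phi> (x k) - \<psi> (x k)" "p - q" "c k"]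
      by (cases "c k \<ge> 0") (auto simp: blinfun.diff_left algebra_simps)
  qed
  also have "\<dots> = (\<phi> - \<psi>) ?v" by (simp add: blinfun.sum_right blinfun.scaleR_right)
  also have "\<dots> \<le> norm (\<phi> - \<psi>) * norm ?v" using norm_blinfun[of "\<phi> - \<psi>" ?v] by simp
  also have "\<dots> \<le> 2 * norm ?v"
    using norm_triangle_ineq4[of \<phi> \<psi>] \<phi>(1) \<psi>(1) by (intro mult_right_mono) auto
  finally show ?thesis by simp
qed

lemma Rosenthal_l1:
  fixes x :: "nat \<Rightarrow> 'a::real_normed_vector"
  assumes "bounded (range x)"
  obtains r where "strict_mono r" "weakly_Cauchy (x \<circ> r)"
  | r :: "nat \<Rightarrow> nat" and \<delta> where "strict_mono r" "\<delta> > 0" "\<And>n c. \<delta> * (\<Sum>k<n. \<bar>c k\<bar>) \<le> norm (\<Sum>k<n. c k *\<^sub>R x (r k))"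
proof (cases "\<exists>r. strict_mono r \<and> weakly_Cauchy (x \<circ> r)")
  case True
  then show ?thesis using that(1) by blast
next
  case False
  from assms obtain M where "\<And>n. norm (x n) \<le> M" by (auto simp: bounded_iff)
  then obtain p q :: real and L where L: "p < q" "infinite L" 
    "hereditarily_oscillating (\<lambda>n. {\<phi> :: 'a \<Rightarrow>\<^sub>L real. q < blinfun_apply \<phi> (x n)}) (\<lambda>n. {\<phi>. blinfun_apply \<phi> (x n) < p}) (cball 0 1) L"
    using weakly_Cauchy_subsequence_or_oscillating[of x M] False by blast
  obtain r :: "nat \<Rightarrow> nat" where r: "strict_mono r" "range r \<subseteq> L"
    "\<forall>\<epsilon> N. \<exists>\<phi>\<in>cball 0 1. \<forall>k<N. \<phi> \<in>
      (if \<epsilon> k then {\<phi> :: 'a \<Rightarrow>\<^sub>L real. q < blinfun_apply \<phi> (x (r k))} else {\<phi>. blinfun_apply \<phi> (x (r k)) < p})"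
    by (rule hereditarily_oscillating_imp_independent[OF L(2,3)])
  show ?thesis
  proof (rule that(2))
    show "strict_mono r" "(q - p) / 2 > 0" using r(1) L(1) by auto
    show "(q - p) / 2 * (\<Sum>k<n. \<bar>c k\<bar>) \<le> norm (\<Sum>k<n. c k *\<^sub>R x (r k))" for n c
      by (rule independent_imp_l1_lower_bound) (rule r(3))
  qed
qed

section \<open>Convex blocks from property (u)\<close>

lemma limitin_weak_topologyD:
  fixes \<phi> :: "'a::real_normed_vector \<Rightarrow>\<^sub>L real"
  assumes "limitin weak_topology z a G"
  shows "((\<lambda>n. blinfun_apply \<phi> (z n)) \<longlongrightarrow> blinfun_apply \<phi> a) G"
proof (rule order_tendstoI)
  have ev: "eventually (\<lambda>n. blinfun_apply \<psi> (z n) < c) G" if "blinfun_apply \<psi> a < c" for \<psi> :: "'a \<Rightarrow>\<^sub>L real" and c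
  proof -
    have "eventually (\<lambda>n. z n \<in> {v. blinfun_apply \<psi> v < c}) G"
      using assms openin_weak_halfspace[of \<psi> c] that unfolding limitin_def by blast
    then show ?thesis by simp
  qed
  show "eventually (\<lambda>n. blinfun_apply \<phi> (z n) < c) G" if "blinfun_apply \<phi> a < c" for c
    by (rule ev) (rule that)
  show "eventually (\<lambda>n. c < blinfun_apply \<phi> (z n)) G" if "c < blinfun_apply \<phi> a" for c
    using ev[of "- \<phi>" "- c"] that by (simp add: blinfun.minus_left)
qed

text \<open>Lets estimates for differences of two points pass to convex combinations without writing down
coefficients.\<close>

lemma convex_hull_functional_difference_le:
  fixes \<phi> :: "'a::real_normed_vector \<Rightarrow>\<^sub>L real"
  assumes AB: "\<And>u v. u \<in> A \<Longrightarrow> v \<in> B \<Longrightarrow> \<bar>\<phi> (v - u)\<bar> \<le> R"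
    and "u \<in> convex hull A" "v \<in> convex hull B"
  shows "\<bar>\<phi> (v - u)\<bar> \<le> R"
proof -
  have convex: "convex {u. \<bar>\<phi> (v - u)\<bar> \<le> R}" for v
  proof -
    have "{u. \<bar>\<phi> (v - u)\<bar> \<le> R} = {u. \<phi> u \<le> \<phi> v + R} \<inter> {u. \<phi> v - R \<le> \<phi> u}"
      by (auto simp: blinfun.diff_right abs_le_iff)
    then show ?thesis by (simp add: convex_Int convex_functional_le convex_functional_ge)
  qed
  have *: "\<bar>\<phi> (v - u)\<bar> \<le> R" if "v \<in> B" for v
  proof -
    have "convex hull A \<subseteq> {u. \<bar>\<phi> (v - u)\<bar> \<le> R}"
      using AB that by (intro hull_minimal convex) auto
    then show ?thesis using assms(2) by blast
  qed
  have "convex hull B \<subseteq> {v. \<bar>\<phi> (u - v)\<bar> \<le> R}"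
  proof (intro hull_minimal convex subsetI CollectI)
    fix v assume "v \<in> B"
    then show "\<bar>\<phi> (u - v)\<bar> \<le> R" using *[of v] by (simp add: blinfun.diff_right abs_minus_commute)
  qed
  then show ?thesis using assms(3) by (auto simp: blinfun.diff_right abs_minus_commute)
qed

text \<open>Let \<open>s n\<close> be the partial sums of the series provided by property \<open>(u)\<close>. As \<open>y n - s n\<close> tends weakly to
\<open>0\<close>, Mazur's theorem gives successive blocks with the same convex combination \<open>w k\<close> of the \<open>y i\<close> and
\<open>S k\<close> of the \<open>s i\<close> at distance less than \<open>1/2^k\<close>. Taking combinations of the pairs \<open>(y i, s i)\<close> is what
keeps the coefficients equal. The variation of \<open>\<phi>\<close> along \<open>S\<close> is at most twice the sum of all
\<open>\<bar>\<phi> (x l)\<bar>\<close>, as each \<open>x l\<close> is counted for at most two consecutive blocks.\<close>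

lemma weakly_Cauchy_blocks:
  fixes y :: "nat \<Rightarrow> 'a::banach"
  assumes u: "property_u TYPE('a)" and y: "weakly_Cauchy y"
  obtains w where "\<And>k. w k \<in> convex hull (y ` {k..})"
    and "\<And>\<phi> :: 'a \<Rightarrow>\<^sub>L real. summable (\<lambda>k. \<bar>\<phi> (w (Suc k)) - \<phi> (w k)\<bar>)"
proof -
  from u y obtain x where x: "weakly_unconditionally_Cauchy x"
    and lim: "limitin weak_topology (\<lambda>n. y n - (\<Sum>i\<le>n. x i)) 0 sequentially"
    unfolding property_u_def by blast
  define s where "s n = (\<Sum>i\<le>n. x i)" for n
  define pair where "pair i = (y i, s i)" for i
  have block: "\<exists>m>n. \<exists>Y S. (Y, S) \<in> convex hull (pair ` {n..<m}) \<and> norm (Y - S) < \<epsilon>"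
    if "\<epsilon> > 0" for n and \<epsilon> :: real
  proof -
    have "0 \<in> closure (convex hull ((\<lambda>i. y i - s i) ` {n..}))"
    proof (rule weak_limit_in_closure_convex_hull)
      show "(\<lambda>i. \<phi> (y i - s i)) \<longlonglongrightarrow> \<phi> 0" for \<phi> :: "'a \<Rightarrow>\<^sub>L real"
        using limitin_weak_topologyD[OF lim] by (simp add: s_def)
      show "eventually (\<lambda>i. y i - s i \<in> (\<lambda>i. y i - s i) ` {n..}) sequentially"
        using eventually_ge_at_top[of n] by eventually_elim auto
    qed
    then have "\<exists>r\<in>convex hull ((\<lambda>i. y i - s i) ` {n..}). dist r 0 < \<epsilon>"
      using that unfolding closure_approachable by blast
    then obtain r where r: "r \<in> convex hull ((\<lambda>i. y i - s i) ` {n..})" "norm r < \<epsilon>"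
      unfolding dist_0_norm by (auto simp only: dist_norm diff_zero)
    from r(1) obtain J where J: "finite J" "J \<subseteq> {n..}" "r \<in> convex hull ((\<lambda>i. y i - s i) ` J)"
      by (rule convex_hull_image_finite)
    obtain m where m: "J \<subseteq> {..<m}" using finite_nat_iff_bounded J(1) by blast
    have "linear (\<lambda>(a, b). a - b :: 'a)" by (rule linearI) (auto simp: algebra_simps)
    from convex_hull_linear_image[OF this, of "pair ` J"]
    have "r \<in> (\<lambda>(a, b). a - b) ` (convex hull (pair ` J))"
      using J(3) by (simp add: image_image pair_def)
    then obtain Y S where YS: "(Y, S) \<in> convex hull (pair ` J)" "r = Y - S" by auto
    have "J \<subseteq> {n..<max m (Suc n)}" using J(2) m by (auto simp: less_max_iff_disj)
    then have "convex hull (pair ` J) \<subseteq> convex hull (pair ` {n..<max m (Suc n)})"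
      by (intro hull_mono image_mono)
    with YS r(2) show ?thesis by (intro exI[of _ "max m (Suc n)"]) auto
  qed
  define P where "P k r \<longleftrightarrow> (case r of (n, m, Y, S) \<Rightarrow>
      k \<le> n \<and> n < m \<and> (Y, S) \<in> convex hull (pair ` {n..<m}) \<and> norm (Y - S) < (1 / 2) ^ k)"
    for k :: nat and r
  have "\<exists>f. \<forall>k. P k (f k) \<and> fst (f (Suc k)) = fst (snd (f k))"
  proof (rule dependent_nat_choice)
    obtain m Y S where "0 < m" "(Y, S) \<in> convex hull (pair ` {0..<m})" "norm (Y - S) < 1"
      using block[OF zero_less_one, of 0] by (elim exE conjE) (rule that)
    then have "P 0 (0, m, Y, S)" by (simp add: P_def)
    then show "\<exists>r. P 0 r" ..
    fix r k assume "P k r"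
    have half: "0 < (1 / 2 :: real) ^ Suc k" by simp
    obtain n m Y S where r_eq: "r = (n, m, Y, S)" by (rule prod_cases4)
    with \<open>P k r\<close> have r: "r = (n, m, Y, S)" "k \<le> n" "n < m" by (simp_all add: P_def)
    obtain m' Y' S' where "m < m'" "(Y', S') \<in> convex hull (pair ` {m..<m'})"
      "norm (Y' - S') < (1 / 2) ^ Suc k"
      using block[OF half, of m] by (elim exE conjE) (rule that)
    then have "P (Suc k) (m, m', Y', S')" using r(2,3) by (simp add: P_def)
    then show "\<exists>r'. P (Suc k) r' \<and> fst r' = fst (snd r)" using r(1) by auto
  qed
  then obtain f where f: "\<And>k. P k (f k)" "\<And>k. fst (f (Suc k)) = fst (snd (f k))" by blast
  define a where "a k = fst (f k)" for k
  define w where "w k = fst (snd (snd (f k)))" for k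
  define S where "S k = snd (snd (snd (f k)))" for k
  have a_less: "a k < a (Suc k)" and a_ge: "k \<le> a k" 
    and hull: "(w k, S k) \<in> convex hull (pair ` {a k..<a (Suc k)})"
    and close: "norm (w k - S k) < (1 / 2) ^ k" for k
    using f(1)[of k] f(2)[of k] by (auto simp: P_def a_def w_def S_def split: prod.splits)
  show thesis
  proof (rule that)
    fix k
    have "w k \<in> fst ` (convex hull (pair ` {a k..<a (Suc k)}))"
      using hull[of k] by force
    also have "\<dots> = convex hull (y ` {a k..<a (Suc k)})"
      by (simp add: convex_hull_linear_image linear_fst image_image pair_def)
    also have "\<dots> \<subseteq> convex hull (y ` {k..})"
      by (intro hull_mono image_mono) (use a_ge[of k] in auto)
    finally show "w k \<in> convex hull (y ` {k..})" .
  next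
    fix \<phi> :: "'a \<Rightarrow>\<^sub>L real"
    define T where "T n = (\<Sum>l<n. \<bar>\<phi> (x l)\<bar>)" for n
    have sx: "summable (\<lambda>l. \<bar>\<phi> (x l)\<bar>)"
      using x by (simp add: weakly_unconditionally_Cauchy_def)
    have T_nonneg: "0 \<le> T n" and T_le: "T n \<le> (\<Sum>l. \<bar>\<phi> (x l)\<bar>)" for n
      unfolding T_def by (auto intro!: sum_nonneg sum_le_suminf sx)
    have S_hull: "S k \<in> convex hull (s ` {a k..<a (Suc k)})" for k
    proof -
      have "S k \<in> snd ` (convex hull (pair ` {a k..<a (Suc k)}))"
        using hull[of k] by force
      then show ?thesis by (simp add: convex_hull_linear_image linear_snd image_image pair_def)
    qed
    have S_diff: "\<bar>\<phi> (S (Suc k) - S k)\<bar> \<le> T (a (Suc (Suc k))) - T (a k)" for k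
    proof (rule convex_hull_functional_difference_le[OF _ S_hull S_hull])
      fix u v assume "u \<in> s ` {a k..<a (Suc k)}" "v \<in> s ` {a (Suc k)..<a (Suc (Suc k))}"
      then obtain i j where ij: "u = s i" "v = s j" "a k \<le> i" "i < j" "j < a (Suc (Suc k))" by auto
      have "s j = s i + (\<Sum>l\<in>{i<..j}. x l)"
        unfolding s_def using ij by (subst sum.union_disjoint[symmetric]) (auto intro!: sum.cong)
      then have "\<bar>\<phi> (v - u)\<bar> = \<bar>\<Sum>l\<in>{i<..j}. \<phi> (x l)\<bar>"
        by (simp add: ij blinfun.sum_right)
      also have "\<dots> \<le> (\<Sum>l\<in>{i<..j}. \<bar>\<phi> (x l)\<bar>)" by (rule sum_abs)
      also have "\<dots> \<le> (\<Sum>l\<in>{a k..<a (Suc (Suc k))}. \<bar>\<phi> (x l)\<bar>)"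
        using ij by (intro sum_mono2) auto
      also have "\<dots> = T (a (Suc (Suc k))) - T (a k)"
        unfolding T_def using a_less[of k] a_less[of "Suc k"]
        by (simp flip: atLeast0LessThan add: sum_diff_nat_ivl)
      finally show "\<bar>\<phi> (v - u)\<bar> \<le> T (a (Suc (Suc k))) - T (a k)" .
    qed
    have sum_T: "summable (\<lambda>k. T (a (Suc (Suc k))) - T (a k))"
    proof (rule summableI_nonneg_bounded)
      show "0 \<le> T (a (Suc (Suc k))) - T (a k)" for k
        using S_diff[of k] by linarith
      fix N
      have "(\<Sum>k<N. T (a (Suc (Suc k))) - T (a k)) = T (a (Suc N)) + T (a N) - T (a 1) - T (a 0)"
        by (induction N) auto
      also have "\<dots> \<le> 2 * (\<Sum>l. \<bar>\<phi> (x l)\<bar>)"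
        using T_le[of "a (Suc N)"] T_le[of "a N"] T_nonneg[of "a 1"] T_nonneg[of "a 0"] by linarith
      finally show "(\<Sum>k<N. T (a (Suc (Suc k))) - T (a k)) \<le> 2 * (\<Sum>l. \<bar>\<phi> (x l)\<bar>)" .
    qed
    have close_\<phi>: "\<bar>\<phi> (w k - S k)\<bar> \<le> norm \<phi> * (1 / 2) ^ k" for k
    proof -
      have "\<bar>\<phi> (w k - S k)\<bar> \<le> norm \<phi> * norm (w k - S k)"
        using norm_blinfun[of \<phi> "w k - S k"] by simp
      also have "\<dots> \<le> norm \<phi> * (1 / 2) ^ k"
        by (intro mult_left_mono less_imp_le[OF close]) simp
      finally show ?thesis .
    qed
    have bound: "\<bar>\<phi> (w (Suc k)) - \<phi> (w k)\<bar> \<le>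
        (T (a (Suc (Suc k))) - T (a k)) + (norm \<phi> * (1 / 2) ^ Suc k + norm \<phi> * (1 / 2) ^ k)" for k
      using S_diff[of k] close_\<phi>[of k] close_\<phi>[of "Suc k"] unfolding blinfun.diff_right by linarith
    show "summable (\<lambda>k. \<bar>\<phi> (w (Suc k)) - \<phi> (w k)\<bar>)"
    proof (rule summable_comparison_test)
      show "\<exists>N. \<forall>k\<ge>N. norm \<bar>\<phi> (w (Suc k)) - \<phi> (w k)\<bar> \<le>
        (T (a (Suc (Suc k))) - T (a k)) + (norm \<phi> * (1 / 2) ^ Suc k + norm \<phi> * (1 / 2) ^ k)"
        using bound by simp
      show "summable (\<lambda>k. (T (a (Suc (Suc k))) - T (a k)) + (norm \<phi> * (1 / 2) ^ Suc k + norm \<phi> * (1 / 2) ^ k))"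
        by (intro summable_add sum_T summable_mult summable_geometric summable_Suc_iff[THEN iffD2]) auto
    qed
  qed
qed

section \<open>Subsequences equivalent to the summing basis\<close>

text \<open>The uniform boundedness principle on the dual, which is complete: by Baire's theorem one of the sets
\<open>A n\<close>, on which the sums are bounded by \<open>n\<close>, contains a ball.\<close>

lemma uniformly_bounded_sums:
  fixes e :: "nat \<Rightarrow> 'a::real_normed_vector"
  assumes e: "\<And>\<phi> :: 'a \<Rightarrow>\<^sub>L real. summable (\<lambda>l. \<bar>\<phi> (e l)\<bar>)"
  obtains B where "\<And>\<phi> N. norm \<phi> \<le> 1 \<Longrightarrow> (\<Sum>l<N. \<bar>blinfun_apply \<phi> (e l)\<bar>) \<le> (B::real)"
proof -
  define A where "A n = {\<phi> :: 'a \<Rightarrow>\<^sub>L real. \<forall>N. (\<Sum>l<N. \<bar>blinfun_apply \<phi> (e l)\<bar>) \<le> real n}" for n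
  have closed: "closed (A n)" for n
    unfolding A_def by (intro closed_Collect_all closed_Collect_le continuous_intros)
  have "\<phi> \<in> (\<Union>n. A n)" for \<phi>
  proof -
    obtain n where "(\<Sum>l. \<bar>blinfun_apply \<phi> (e l)\<bar>) \<le> real n" using real_arch_simple by blast
    moreover have "(\<Sum>l<N. \<bar>blinfun_apply \<phi> (e l)\<bar>) \<le> (\<Sum>l. \<bar>blinfun_apply \<phi> (e l)\<bar>)" for N
      by (intro sum_le_suminf e) auto
    ultimately show ?thesis by (auto simp: A_def intro: order_trans)
  qed
  then have cover: "(\<Union>n. A n) = UNIV" by blast
  have "\<exists>n. euclidean interior_of (A n) \<noteq> {}"
  proof (rule ccontr)
    assume "\<nexists>n. euclidean interior_of (A n) \<noteq> {}"
    then have "euclidean interior_of (\<Union> (range A)) = {}"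
      using closed by (intro Baire_category_alt disjI1 completely_metrizable_space_euclidean) auto
    with cover show False by (metis interior_of_topspace topspace_euclidean UNIV_not_empty)
  qed
  then obtain n \<phi>0 where "\<phi>0 \<in> euclidean interior_of (A n)" by blast
  then obtain U where U: "open U" "\<phi>0 \<in> U" "U \<subseteq> A n" unfolding interior_of_def by auto
  then obtain r where r: "r > 0" "cball \<phi>0 r \<subseteq> A n" by (meson open_contains_cball order_trans)
  show thesis
  proof (rule that)
    fix \<phi> :: "'a \<Rightarrow>\<^sub>L real" and N assume \<phi>: "norm \<phi> \<le> 1"
    have "\<phi>0 + r *\<^sub>R \<phi> \<in> A n" "\<phi>0 \<in> A n"
      using r \<phi> by (auto intro!: subsetD[OF r(2)] simp: dist_norm mult_le_one)
    then have *: "(\<Sum>l<N. \<bar>blinfun_apply (\<phi>0 + r *\<^sub>R \<phi>) (e l)\<bar>) \<le> real n" "(\<Sum>l<N. \<bar>blinfun_apply \<phi>0 (e l)\<bar>) \<le> real n"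
      by (auto simp: A_def)
    have "r * (\<Sum>l<N. \<bar>\<phi> (e l)\<bar>) = (\<Sum>l<N. \<bar>blinfun_apply (\<phi>0 + r *\<^sub>R \<phi>) (e l) - blinfun_apply \<phi>0 (e l)\<bar>)"
      using r(1) by (simp add: sum_distrib_left blinfun.add_left blinfun.scaleR_left abs_mult)
    also have "\<dots> \<le> (\<Sum>l<N. \<bar>blinfun_apply (\<phi>0 + r *\<^sub>R \<phi>) (e l)\<bar> + \<bar>blinfun_apply \<phi>0 (e l)\<bar>)"
      by (intro sum_mono abs_triangle_ineq4)
    also have "\<dots> \<le> 2 * real n" using * by (simp add: sum.distrib)
    finally show "(\<Sum>l<N. \<bar>\<phi> (e l)\<bar>) \<le> 2 * real n / r" using r(1) by (simp add: field_simps)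
  qed
qed

text \<open>Summation by parts: relative to the differences of \<open>v\<close>, the coefficients are the tail sums of \<open>c\<close>.\<close>

lemma sum_scaleR_by_parts:
  fixes v :: "nat \<Rightarrow> 'a::real_vector"
  shows "(\<Sum>i<n. c i *\<^sub>R v i) =
    (\<Sum>l<n. (\<Sum>i\<in>{l..<n}. c i) *\<^sub>R (v l - (if l = 0 then 0 else v (l - 1))))"
proof (induction n)
  case (Suc n)
  define e where "e l = v l - (if l = 0 then 0 else v (l - 1))" for l
  have e_sum: "(\<Sum>l<Suc m. e l) = v m" for m
    by (induction m) (auto simp: e_def)
  have "(\<Sum>l<Suc n. (\<Sum>i\<in>{l..<Suc n}. c i) *\<^sub>R e l) =
      (\<Sum>l<Suc n. (\<Sum>i\<in>{l..<n}. c i) *\<^sub>R e l + c n *\<^sub>R e l)"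
    by (rule sum.cong) (auto simp: scaleR_add_left)
  also have "\<dots> = (\<Sum>l<n. (\<Sum>i\<in>{l..<n}. c i) *\<^sub>R e l) + c n *\<^sub>R (\<Sum>l<Suc n. e l)"
    by (simp only: sum.distrib scaleR_sum_right) simp
  finally show ?case using Suc unfolding e_sum by (simp add: e_def)
qed simp

lemma variation_along_subsequence_le:
  fixes f :: "nat \<Rightarrow> real"
  assumes "strict_mono m"
  shows "(\<Sum>l\<in>{p..<n}. \<bar>f (m (Suc l)) - f (m l)\<bar>) \<le> (\<Sum>j\<in>{m p..<m n}. \<bar>f (Suc j) - f j\<bar>)"
proof (cases "p \<le> n")
  case True
  then show ?thesis
  proof (induction n rule: dec_induct)
    case (step n)
    have le: "m p \<le> m n" "m n \<le> m (Suc n)"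
      using assms step(1) by (auto simp: strict_mono_less_eq)
    have "f (m (Suc n)) - f (m n) = (\<Sum>j\<in>{m n..<m (Suc n)}. f (Suc j) - f j)"
      using le by (simp add: sum_Suc_diff')
    then have "\<bar>f (m (Suc n)) - f (m n)\<bar> \<le> (\<Sum>j\<in>{m n..<m (Suc n)}. \<bar>f (Suc j) - f j\<bar>)"
      by (simp add: sum_abs)
    then show ?case
      using step sum.atLeastLessThan_concat[OF le, of "\<lambda>j. \<bar>f (Suc j) - f j\<bar>"] by simp
  qed simp
qed simp

text \<open>Let \<open>F \<phi> = lim \<phi> (w n)\<close>, which is not an evaluation. Helly's theorem gives functionals \<open>\<psi> k\<close> with
\<open>F (\<psi> k) > d\<close> that are small at the points selected so far; the next point \<open>w (m k)\<close> is taken so late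
that \<open>\<psi> k\<close> already exceeds \<open>d\<close> there and hardly varies afterwards. With respect to the differences \<open>e l\<close> of the
selected points, \<open>\<psi> k\<close> is then nearly a multiple of the \<open>k\<close>-th coordinate functional. Evaluated for the
\<open>k\<close> where the tail sum is largest, it gives the lower bound, while the upper bound is the uniform
boundedness of the sums of \<open>\<bar>\<phi> (e l)\<bar>\<close>.\<close>

lemma summing_subsequence:
  fixes w :: "nat \<Rightarrow> 'a::banach"
  assumes bdd: "bounded (range w)"
    and var: "\<And>\<phi> :: 'a \<Rightarrow>\<^sub>L real. summable (\<lambda>k. \<bar>\<phi> (w (Suc k)) - \<phi> (w k)\<bar>)"
    and no_limit: "\<And>z. \<exists>\<phi> :: 'a \<Rightarrow>\<^sub>L real. \<not> (\<lambda>n. \<phi> (w n)) \<longlonglongrightarrow> \<phi> z"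
  obtains m :: "nat \<Rightarrow> nat" and \<delta> B where "strict_mono m" "\<delta> > 0"
    "\<And>n c l. l < n \<Longrightarrow> \<delta> * \<bar>\<Sum>i\<in>{l..<n}. c i\<bar> \<le> norm (\<Sum>i<n. c i *\<^sub>R w (m i))"
    "\<And>n c G. (\<And>l. l < n \<Longrightarrow> \<bar>\<Sum>i\<in>{l..<n}. c i\<bar> \<le> G) \<Longrightarrow> 0 \<le> G \<Longrightarrow>
      norm (\<Sum>i<n. c i *\<^sub>R w (m i)) \<le> B * G"
proof -
  define F :: "('a \<Rightarrow>\<^sub>L real) \<Rightarrow> real" where "F \<phi> = lim (\<lambda>n. \<phi> (w n))" for \<phi>
  have F_lim: "(\<lambda>n. \<phi> (w n)) \<longlonglongrightarrow> F \<phi>" for \<phi> :: "'a \<Rightarrow>\<^sub>L real"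
  proof -
    have "summable (\<lambda>k. \<phi> (w (Suc k)) - \<phi> (w k))" using var by (rule summable_rabs_cancel)
    then have "convergent (\<lambda>n. \<phi> (w 0) + (\<Sum>k<n. \<phi> (w (Suc k)) - \<phi> (w k)))"
      by (intro convergent_add convergent_const) (simp add: summable_iff_convergent)
    moreover have "\<phi> (w 0) + (\<Sum>k<n. \<phi> (w (Suc k)) - \<phi> (w k)) = \<phi> (w n)" for n
      using sum_lessThan_telescope[of "\<lambda>k. \<phi> (w k)" n] by simp
    ultimately show ?thesis unfolding F_def by (simp add: convergent_LIMSEQ_iff)
  qed
  have F_lin: "linear F"
  proof (rule linearI)
    fix \<phi> \<psi> :: "'a \<Rightarrow>\<^sub>L real" and r :: real
    have "(\<lambda>n. blinfun_apply (\<phi> + \<psi>) (w n)) \<longlonglongrightarrow> F \<phi> + F \<psi>"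
      unfolding blinfun.add_left by (intro tendsto_add F_lim)
    then show "F (\<phi> + \<psi>) = F \<phi> + F \<psi>" using F_lim LIMSEQ_unique by blast
    have "(\<lambda>n. blinfun_apply (r *\<^sub>R \<phi>) (w n)) \<longlonglongrightarrow> r *\<^sub>R F \<phi>"
      unfolding blinfun.scaleR_left by (intro tendsto_scaleR tendsto_const F_lim)
    then show "F (r *\<^sub>R \<phi>) = r *\<^sub>R F \<phi>" using F_lim LIMSEQ_unique by blast
  qed
  have "\<exists>\<phi>. F \<phi> \<noteq> blinfun_apply \<phi> z" for z
    using no_limit[of z] F_lim by metis
  with F_lin obtain d where d: "d > 0" "\<And>z. \<exists>\<phi>. norm \<phi> \<le> 1 \<and> d < F \<phi> - blinfun_apply \<phi> z"
    by (rule distance_from_evaluations) blast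
  define P where "P h k r \<longleftrightarrow> norm (fst r) \<le> 1 \<and>
      (\<forall>i<k. snd (h i) < snd r \<and> \<bar>blinfun_apply (fst r) (w (snd (h i)))\<bar> < d / (8 * real (Suc k))) \<and>
      d < blinfun_apply (fst r) (w (snd r)) \<and>
      (\<forall>q. (\<Sum>l\<in>{snd r..<q}. \<bar>blinfun_apply (fst r) (w (Suc l)) - blinfun_apply (fst r) (w l)\<bar>) \<le> d / 8)"
    for h :: "nat \<Rightarrow> ('a \<Rightarrow>\<^sub>L real) \<times> nat" and k r
  have "\<exists>f. \<forall>k. P f k (f k)"
  proof (rule dependent_wellorder_choice)
    show "P f k r = P g k r" if "\<And>i. i < k \<Longrightarrow> f i = g i" for r f g k
      using that by (auto simp: P_def)
    fix k and f :: "nat \<Rightarrow> ('a \<Rightarrow>\<^sub>L real) \<times> nat"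
    have "d / (8 * real (Suc k)) > 0" using d(1) by simp
    then obtain \<psi> where \<psi>: "norm \<psi> \<le> 1" "d < F \<psi>"
      "\<And>i. i < k \<Longrightarrow> \<bar>blinfun_apply \<psi> (w (snd (f i)))\<bar> < d / (8 * real (Suc k))"
      by (rule functional_small_on_finitely_many_points[OF F_lin d(2), where n = k and a = "\<lambda>i. w (snd (f i))"]) blast
    have ev_large: "eventually (\<lambda>m. d < \<psi> (w m)) sequentially"
      using order_tendstoD(1)[OF F_lim \<psi>(2)] .
    have ev_beyond: "eventually (\<lambda>m. \<forall>i<k. snd (f i) < m) sequentially"
      using eventually_ball_finite[of "{..<k}" "\<lambda>m i. snd (f i) < m"] eventually_gt_at_top by (auto simp: Ball_def)
    obtain N where N: "\<And>m q. m \<ge> N \<Longrightarrow> norm (\<Sum>l\<in>{m..<q}. \<bar>\<psi> (w (Suc l)) - \<psi> (w l)\<bar>) < d / 8"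
      using summable_Cauchy[THEN iffD1, OF var[of \<psi>]] d(1) by (metis zero_less_divide_iff zero_less_numeral)
    obtain m where m: "d < \<psi> (w m)" "\<forall>i<k. snd (f i) < m" "N \<le> m"
      using eventually_happens[OF eventually_conj[OF ev_large eventually_conj[OF ev_beyond eventually_ge_at_top[of N]]]]
      by auto
    have "(\<Sum>l\<in>{m..<q}. \<bar>\<psi> (w (Suc l)) - \<psi> (w l)\<bar>) \<le> d / 8" for q
      using N[OF m(3), of q] by simp
    then have "P f k (\<psi>, m)" using m \<psi> by (auto simp: P_def)
    then show "\<exists>r. P f k r" ..
  qed
  then obtain f where f: "\<And>k. P f k (f k)" by blast
  define \<psi> where "\<psi> k = fst (f k)" for k
  define m where "m k = snd (f k)" for k
  define v where "v k = w (m k)" for k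
  have \<psi>_norm: "norm (\<psi> k) \<le> 1"
    and m_less: "i < k \<Longrightarrow> m i < m k"
    and small: "i < k \<Longrightarrow> \<bar>\<psi> k (v i)\<bar> < d / (8 * real (Suc k))"
    and large: "d < \<psi> k (v k)"
    and tail: "(\<Sum>l\<in>{m k..<q}. \<bar>\<psi> k (w (Suc l)) - \<psi> k (w l)\<bar>) \<le> d / 8" for i k q
    using f[of k] by (auto simp: P_def \<psi>_def m_def v_def)
  have m: "strict_mono m" using m_less by (intro strict_monoI)
  define e where "e l = v l - (if l = 0 then 0 else v (l - 1))" for l
  have parts: "(\<Sum>i<n. c i *\<^sub>R w (m i)) = (\<Sum>l<n. (\<Sum>i\<in>{l..<n}. c i) *\<^sub>R e l)" for n c
    using sum_scaleR_by_parts[of c v n] by (simp add: v_def e_def)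
  obtain M where M: "\<And>k. norm (w k) \<le> M" using bdd by (auto simp: bounded_iff)
  obtain B where B: "\<And>(\<phi> :: 'a \<Rightarrow>\<^sub>L real) N. norm \<phi> \<le> 1 \<Longrightarrow> (\<Sum>l<N. \<bar>blinfun_apply \<phi> (w (Suc l) - w l)\<bar>) \<le> B"
    using uniformly_bounded_sums[of "\<lambda>l. w (Suc l) - w l"] var by (auto simp: blinfun.diff_right)
  have e_later: "(\<Sum>l\<in>{Suc k..<n}. \<bar>\<phi> (e l)\<bar>) \<le> (\<Sum>l\<in>{m k..<m n}. \<bar>\<phi> (w (Suc l)) - \<phi> (w l)\<bar>)"
    for \<phi> :: "'a \<Rightarrow>\<^sub>L real" and k n
  proof (cases n)
    case (Suc n')
    have "(\<Sum>l\<in>{Suc k..<n}. \<bar>\<phi> (e l)\<bar>) = (\<Sum>l\<in>{k..<n'}. \<bar>\<phi> (w (m (Suc l))) - \<phi> (w (m l))\<bar>)"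
      unfolding Suc sum.shift_bounds_Suc_ivl by (simp add: e_def v_def blinfun.diff_right)
    also have "\<dots> \<le> (\<Sum>l\<in>{m k..<m n'}. \<bar>\<phi> (w (Suc l)) - \<phi> (w l)\<bar>)"
      by (rule variation_along_subsequence_le[OF m])
    also have "\<dots> \<le> (\<Sum>l\<in>{m k..<m n}. \<bar>\<phi> (w (Suc l)) - \<phi> (w l)\<bar>)"
      using m_less[of n' n] Suc by (intro sum_mono2) auto
    finally show ?thesis .
  qed (simp add: sum_nonneg)
  show thesis
  proof (rule that[OF m])
    show "d / 2 > 0" using d(1) by simp
    fix n :: nat and c :: "nat \<Rightarrow> real" and G :: real
    assume G: "\<And>l. l < n \<Longrightarrow> \<bar>\<Sum>i\<in>{l..<n}. c i\<bar> \<le> G" "0 \<le> G"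
    let ?u = "\<Sum>i<n. c i *\<^sub>R w (m i)"
    obtain \<phi> :: "'a \<Rightarrow>\<^sub>L real" where \<phi>: "norm \<phi> \<le> 1" "norm ?u \<le> \<phi> ?u" by (rule norming_functional)
    have "(\<Sum>l<n. \<bar>\<phi> (e l)\<bar>) \<le> \<bar>\<phi> (e 0)\<bar> + (\<Sum>l\<in>{Suc 0..<n}. \<bar>\<phi> (e l)\<bar>)"
      by (cases n) (auto simp: lessThan_atLeast0 sum.atLeast_Suc_lessThan)
    also have "\<bar>\<phi> (e 0)\<bar> \<le> M"
      using norm_blinfun[of \<phi> "w (m 0)"] mult_right_mono[OF \<phi>(1), of "norm (w (m 0))"] M[of "m 0"]
      by (simp add: e_def v_def)
    also have "(\<Sum>l\<in>{Suc 0..<n}. \<bar>\<phi> (e l)\<bar>) \<le> (\<Sum>l\<in>{m 0..<m n}. \<bar>\<phi> (w (Suc l)) - \<phi> (w l)\<bar>)"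
      by (rule e_later)
    also have "\<dots> \<le> (\<Sum>l<m n. \<bar>\<phi> (w (Suc l) - w l)\<bar>)"
      unfolding blinfun.diff_right by (intro sum_mono2) auto
    also have "\<dots> \<le> B" by (rule B[OF \<phi>(1)])
    finally have e_bound: "(\<Sum>l<n. \<bar>\<phi> (e l)\<bar>) \<le> M + B" by simp
    have "norm ?u \<le> (\<Sum>l<n. (\<Sum>i\<in>{l..<n}. c i) * \<phi> (e l))"
      using \<phi>(2) by (simp add: parts blinfun.sum_right blinfun.scaleR_right)
    also have "\<dots> \<le> (\<Sum>l<n. G * \<bar>\<phi> (e l)\<bar>)"
    proof (rule sum_mono)
      fix l assume "l \<in> {..<n}"
      then have "\<bar>(\<Sum>i\<in>{l..<n}. c i) * \<phi> (e l)\<bar> \<le> G * \<bar>\<phi> (e l)\<bar>"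
        unfolding abs_mult using G(1)[of l] by (intro mult_right_mono) auto
      then show "(\<Sum>i\<in>{l..<n}. c i) * \<phi> (e l) \<le> G * \<bar>\<phi> (e l)\<bar>" by linarith
    qed
    also have "\<dots> \<le> (M + B) * G"
      using mult_left_mono[OF e_bound G(2)] by (simp add: sum_distrib_left mult.commute)
    finally show "norm ?u \<le> (M + B) * G" .
  next
    fix n l :: nat and c :: "nat \<Rightarrow> real" assume "l < n"
    define \<gamma> where "\<gamma> l = (\<Sum>i\<in>{l..<n}. c i :: real)" for l
    let ?u = "\<Sum>i<n. c i *\<^sub>R w (m i)"
    have "{..<n} \<noteq> {}" using \<open>l < n\<close> by auto
    then obtain k where k: "k < n" "\<And>j. j < n \<Longrightarrow> \<bar>\<gamma> j\<bar> \<le> \<bar>\<gamma> k\<bar>"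
      using Max_in[of "(\<lambda>j. \<bar>\<gamma> j\<bar>) ` {..<n}"] Max_ge[of "(\<lambda>j. \<bar>\<gamma> j\<bar>) ` {..<n}"] by fastforce
    have frac: "d / (8 * real (Suc k)) \<le> d / 8"
      using d(1) by (intro divide_left_mono) auto
    \<comment> \<open>The three estimates leave \<open>d - d/8 - d/4 - d/8 = d/2\<close> for the \<open>k\<close>-th coordinate.\<close>
    have diag: "d - d / 8 \<le> \<psi> k (e k)"
    proof (cases "k = 0")
      case True
      then show ?thesis using large[of k] d(1) by (simp add: e_def)
    next
      case False
      then have "\<psi> k (e k) = \<psi> k (v k) - \<psi> k (v (k - 1))" by (simp add: e_def blinfun.diff_right)
      moreover have "\<bar>\<psi> k (v (k - 1))\<bar> < d / (8 * real (Suc k))" using small[of "k - 1" k] False by simp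
      ultimately show ?thesis using large[of k] frac by linarith
    qed
    have before: "(\<Sum>j<k. \<bar>\<psi> k (e j)\<bar>) \<le> d / 4"
    proof -
      have "(\<Sum>j<k. \<bar>\<psi> k (e j)\<bar>) \<le> (\<Sum>j<k. 2 * (d / (8 * real (Suc k))))"
      proof (rule sum_mono)
        fix j assume "j \<in> {..<k}"
        then have "\<bar>\<psi> k (v j)\<bar> < d / (8 * real (Suc k))" "\<bar>\<psi> k (v (j - 1))\<bar> < d / (8 * real (Suc k))"
          using small[of j k] small[of "j - 1" k] by auto
        moreover have "\<bar>\<psi> k (e j)\<bar> \<le> \<bar>\<psi> k (v j)\<bar> + \<bar>\<psi> k (v (j - 1))\<bar>"
          by (cases "j = 0") (auto simp: e_def blinfun.diff_right abs_triangle_ineq4)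
        ultimately show "\<bar>\<psi> k (e j)\<bar> \<le> 2 * (d / (8 * real (Suc k)))" by linarith
      qed
      also have "\<dots> = d / 4 * (real k / real (Suc k))" by (simp add: field_simps del: of_nat_Suc)
      also have "\<dots> \<le> d / 4 * 1" using d(1) by (intro mult_left_mono) auto
      finally show ?thesis by simp
    qed
    have after: "(\<Sum>j\<in>{Suc k..<n}. \<bar>\<psi> k (e j)\<bar>) \<le> d / 8"
      using e_later[of "\<psi> k" k n] tail[of k "m n"] by linarith
    have split: "(\<Sum>j<n. h j) = (\<Sum>j<k. h j) + h k + (\<Sum>j\<in>{Suc k..<n}. h j)" for h :: "nat \<Rightarrow> real"
      using k(1) sum.atLeastLessThan_concat[of 0 k n h]
      by (simp add: lessThan_atLeast0 sum.atLeast_Suc_lessThan[of k n h])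
    have off: "\<bar>\<gamma> j * \<psi> k (e j)\<bar> \<le> \<bar>\<gamma> k\<bar> * \<bar>\<psi> k (e j)\<bar>" if "j < n" for j
      unfolding abs_mult using k(2)[OF that] by (intro mult_right_mono) auto
    have off_sum: "\<bar>\<Sum>j\<in>J. \<gamma> j * \<psi> k (e j)\<bar> \<le> \<bar>\<gamma> k\<bar> * (\<Sum>j\<in>J. \<bar>\<psi> k (e j)\<bar>)" if "J \<subseteq> {..<n}" for J
      unfolding sum_distrib_left by (rule order_trans[OF sum_abs sum_mono]) (use off that in auto)
    have "\<bar>\<gamma> k\<bar> * (d - d / 8) \<le> \<bar>\<gamma> k\<bar> * \<bar>\<psi> k (e k)\<bar>"
      using diag by (intro mult_left_mono) auto
    moreover have "\<bar>\<gamma> k\<bar> * (\<Sum>j<k. \<bar>\<psi> k (e j)\<bar>) \<le> \<bar>\<gamma> k\<bar> * (d / 4)"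
      by (rule mult_left_mono[OF before]) simp
    moreover have "\<bar>\<gamma> k\<bar> * (\<Sum>j\<in>{Suc k..<n}. \<bar>\<psi> k (e j)\<bar>) \<le> \<bar>\<gamma> k\<bar> * (d / 8)"
      by (rule mult_left_mono[OF after]) simp
    moreover have "\<psi> k ?u = (\<Sum>j<k. \<gamma> j * \<psi> k (e j)) + \<gamma> k * \<psi> k (e k) + (\<Sum>j\<in>{Suc k..<n}. \<gamma> j * \<psi> k (e j))"
      using split[of "\<lambda>j. \<gamma> j * \<psi> k (e j)"]
      by (simp add: parts \<gamma>_def blinfun.sum_right blinfun.scaleR_right)
    moreover have "\<bar>\<gamma> k * \<psi> k (e k)\<bar> = \<bar>\<gamma> k\<bar> * \<bar>\<psi> k (e k)\<bar>" by (rule abs_mult)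
    moreover have "{..<k} \<subseteq> {..<n}" "{Suc k..<n} \<subseteq> {..<n}" using k(1) by auto
    note off_sum[OF this(1)] off_sum[OF this(2)]
    ultimately have "\<bar>\<gamma> k\<bar> * (d - d / 8) - \<bar>\<gamma> k\<bar> * (d / 4) - \<bar>\<gamma> k\<bar> * (d / 8) \<le> \<bar>\<psi> k ?u\<bar>"
      by linarith
    also have "\<bar>\<gamma> k\<bar> * (d - d / 8) - \<bar>\<gamma> k\<bar> * (d / 4) - \<bar>\<gamma> k\<bar> * (d / 8) = d / 2 * \<bar>\<gamma> k\<bar>"
      by (simp add: algebra_simps)
    also have "\<bar>\<psi> k ?u\<bar> \<le> norm ?u"
      using norm_blinfun[of "\<psi> k" ?u] mult_right_mono[OF \<psi>_norm[of k], of "norm ?u"] by simp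
    finally have "d / 2 * \<bar>\<gamma> k\<bar> \<le> norm ?u" .
    moreover have "d / 2 * \<bar>\<gamma> l\<bar> \<le> d / 2 * \<bar>\<gamma> k\<bar>"
      using k(2)[OF \<open>l < n\<close>] d(1) by (intro mult_left_mono) auto
    ultimately show "d / 2 * \<bar>\<Sum>i\<in>{l..<n}. c i\<bar> \<le> norm ?u" by (simp add: \<gamma>_def)
  qed
qed

section \<open>The characterization of weak compactness\<close>

lemma noncompact_imp_not_FPP:
  fixes C :: "'a::banach set"
  assumes u: "property_u TYPE('a)"
    and C: "C \<noteq> {}" "bounded C" "closed C" "convex C" and nc: "\<not> compactin weak_topology C"
  shows "\<not> has_G_FPP C affine_uniformly_bilipschitz_maps"
proof -
  obtain y :: "nat \<Rightarrow> 'a" where y: "range y \<subseteq> C" "(\<Inter>p. closure (convex hull (y ` {p..}))) = {}"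
    by (rule noncompact_imp_empty_tail_intersection[OF C(2-4,1) nc])
  have "bounded (range y)" using C(2) y(1) by (rule bounded_subset)
  then show ?thesis
  proof (rule Rosenthal_l1)
    fix r :: "nat \<Rightarrow> nat" and \<delta> :: real
    assume r: "strict_mono r" and \<delta>: "\<delta> > 0"
      and l1: "\<And>n c. \<delta> * (\<Sum>k<n. \<bar>c k\<bar>) \<le> norm (\<Sum>k<n. c k *\<^sub>R y (r k))"
    show ?thesis
    proof (rule l1_basis_imp_not_FPP[OF \<delta> _ empty_tail_intersection_subsequence[OF y(2) r] _ C(2-4)])
      show "range (y \<circ> r) \<subseteq> C" using y(1) by (auto simp: image_subset_iff)
    qed (use l1 in simp)
  next
    fix r :: "nat \<Rightarrow> nat" assume r: "strict_mono r" and wC: "weakly_Cauchy (y \<circ> r)"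
    obtain w where w: "\<And>k. w k \<in> convex hull ((y \<circ> r) ` {k..})"
      and var: "\<And>\<phi> :: 'a \<Rightarrow>\<^sub>L real. summable (\<lambda>k. \<bar>\<phi> (w (Suc k)) - \<phi> (w k)\<bar>)"
      by (rule weakly_Cauchy_blocks[OF u wC]) blast
    have tails: "(\<Inter>p. closure (convex hull (w ` {p..}))) = {}"
      by (rule empty_tail_intersection_blocks[OF empty_tail_intersection_subsequence[OF y(2) r] w])
    have wsub: "range w \<subseteq> C"
    proof -
      have "convex hull ((y \<circ> r) ` {k..}) \<subseteq> C" for k
        using y(1) C(4) by (intro hull_minimal) (auto simp: image_subset_iff)
      then show ?thesis using w by blast
    qed
    have no_limit: "\<exists>\<phi> :: 'a \<Rightarrow>\<^sub>L real. \<not> (\<lambda>n. \<phi> (w n)) \<longlonglongrightarrow> \<phi> z" for z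
    proof (rule ccontr)
      assume "\<not> ?thesis"
      then have "\<And>\<phi> :: 'a \<Rightarrow>\<^sub>L real. (\<lambda>n. \<phi> (w n)) \<longlonglongrightarrow> \<phi> z" by blast
      then have "z \<in> closure (convex hull (w ` {p..}))" for p
        by (rule weak_limit_in_closure_convex_hull) (auto simp: eventually_sequentially)
      with tails show False by blast
    qed
    obtain m :: "nat \<Rightarrow> nat" and \<delta> B where m: "strict_mono m" and \<delta>: "\<delta> > 0"
      and lower: "\<And>n c l. l < n \<Longrightarrow> \<delta> * \<bar>\<Sum>i\<in>{l..<n}. c i\<bar> \<le> norm (\<Sum>i<n. c i *\<^sub>R w (m i))"
      and upper: "\<And>n c G. (\<And>l. l < n \<Longrightarrow> \<bar>\<Sum>i\<in>{l..<n}. c i\<bar> \<le> G) \<Longrightarrow> 0 \<le> G \<Longrightarrow>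
        norm (\<Sum>i<n. c i *\<^sub>R w (m i)) \<le> B * G"
      by (rule summing_subsequence[OF bounded_subset[OF C(2) wsub] var no_limit]) blast
    show ?thesis
    proof (rule summing_basis_imp_not_FPP[OF \<delta> _ _ empty_tail_intersection_subsequence[OF tails m] _ C(2-4)])
      show "\<delta> * \<bar>\<Sum>i\<in>{l..<n}. c i\<bar> \<le> norm (\<Sum>i<n. c i *\<^sub>R (w \<circ> m) i)" if "l < n" for n c l
        using lower[OF that] by simp
      show "norm (\<Sum>i<n. c i *\<^sub>R (w \<circ> m) i) \<le> B * G"
        if "\<And>l. l < n \<Longrightarrow> \<bar>\<Sum>i\<in>{l..<n}. c i\<bar> \<le> G" "0 \<le> G" for n c G
        using upper[OF that] by simp
    qed (use wsub in auto)
  qed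
qed

theorem theorem7p1:
  fixes C :: "'a::banach set"
  assumes "property_u TYPE('a)"
    and "C \<noteq> {}" and "bounded C" and "closed C" and "convex C"
  shows "compactin weak_topology C \<longleftrightarrow> has_G_FPP C affine_uniformly_bilipschitz_maps"
proof
  assume comp: "compactin weak_topology C"
  show "has_G_FPP C affine_uniformly_bilipschitz_maps"
    unfolding has_G_FPP_def
  proof (intro ballI impI)
    fix K f assume K: "K \<in> bounded_closed_convex_subsets C"
      and f: "f \<in> affine_uniformly_bilipschitz_maps K" "f ` K \<subseteq> K"
    from f(1) obtain L where "affine_map_on K f" and L: "\<And>p. L-lipschitz_on K (f ^^ p)"
      by (auto simp: affine_uniformly_bilipschitz_maps_def uniformly_bilipschitz_on_def uniformly_lipschitz_on_def)
    moreover have "continuous_on K f" using L[of 1] by (simp add: lipschitz_on_continuous_on)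
    ultimately show "\<exists>x\<in>K. f x = x"
      using weakly_compact_imp_affine_fixed_point[OF comp K _ f(2)] by blast
  qed
next
  assume "has_G_FPP C affine_uniformly_bilipschitz_maps"
  then show "compactin weak_topology C" using noncompact_imp_not_FPP assms by blast
qed

end
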